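(* Let $K$ be a field, $S=K[t_1,t_2,t_3]$ and let $I$ be an ideal of $S$. Then $I$ is a homogeneous lattice ideal of dimension $1$ if and only if $I$ is a CB ideal.
   Context: For $a\in\mathbb{Z}^3$ write $a=a^+-a^-$ with $a^\pm\in\mathbb{N}^3$ of disjoint support ($\mathbb{N}=\{0,1,\ldots\}$). A lattice ideal is an ideal of the form $I(\mathcal{L})=(t^{a^+}-t^{a^-}\mid a\in\mathcal{L})$ for a subgroup (lattice) $\mathcal{L}\subset\mathbb{Z}^3$. Homogeneous means homogeneous with respect to some grading of $S$ with $\deg t_i=d_i$ a positive integer. The dimension of $I$ is the Krull dimension of $S/I$. A $3\times3$ CB (critical binomial) matrix is an integer matrix $L$ with positive diagonal entries, non-positive off-diagonal entries, at least one non-zero off-diagonal entry in each column, and $L\mathbf{1}^\top=0$, where $\mathbf{1}=(1,1,1)$. A CB ideal is an ideal of the form $I(L)=(f_1,f_2,f_3)$ for some CB matrix $L$, where $f_i=t^{a^+}-t^{a^-}$ with $a$ the $i$-th column of $L$. *)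

theory Defs
  imports
    "HOL-Analysis.Analysis"
    "HOL-Library.Poly_Mapping"
    "HOL-Algebra.Algebra"
    "HOL-Algebra.Algebraic_Closure_Type"
begin

text \<open>
  \<open>K[t\<^sub>1, t\<^sub>2, t\<^sub>3]\<close> is the monoid algebra of \<open>\<nat>\<^sup>3\<close> over \<open>K\<close>: finitely supported functions from
  exponent vectors to coefficients, with convolution as product.  Ideals of it are treated as
  ideals of the associated \<open>HOL-Algebra\<close> ring.
\<close>

type_synonym 'k poly3 = "(nat ^ 3) \<Rightarrow>\<^sub>0 'k"

abbreviation S :: "'k::field poly3 ring"
  where "S \<equiv> ring_of_type_algebra"

abbreviation ideal_gen :: "'k::field poly3 set \<Rightarrow> 'k poly3 set"
  where "ideal_gen G \<equiv> Idl\<^bsub>S\<^esub> G"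

definition pos_part :: "int ^ 3 \<Rightarrow> nat ^ 3"
  where "pos_part a = (\<chi> i. nat (a $ i))"

definition neg_part :: "int ^ 3 \<Rightarrow> nat ^ 3"
  where "neg_part a = (\<chi> i. nat (- (a $ i)))"

definition monomial :: "nat ^ 3 \<Rightarrow> 'k::field poly3"
  where "monomial m = Poly_Mapping.single m 1"

definition binomial :: "int ^ 3 \<Rightarrow> 'k::field poly3"
  where "binomial a = monomial (pos_part a) - monomial (neg_part a)"


text \<open>
  The subgroups of \<open>\<int>\<^sup>3\<close> are expressed by \<^const>\<open>additive_subgroup\<close>, which refers to the additive
  group of the ring \<open>\<int>\<^sup>3\<close> only.
\<close>

definition lattice_ideal :: "'k::field poly3 set \<Rightarrow> bool"
  where "lattice_ideal I \<longleftrightarrow>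
    (\<exists>\<L> :: (int ^ 3) set. additive_subgroup \<L> ring_of_type_algebra \<and>
      I = ideal_gen (binomial ` \<L>))"

definition weighted_degree :: "nat ^ 3 \<Rightarrow> nat ^ 3 \<Rightarrow> nat"
  where "weighted_degree d m = (\<Sum>i\<in>UNIV. d $ i * m $ i)"

text \<open>The zero polynomial, which has no keys, is homogeneous.\<close>

definition homogeneous_poly :: "nat ^ 3 \<Rightarrow> 'k::field poly3 \<Rightarrow> bool"
  where "homogeneous_poly d f \<longleftrightarrow> (\<exists>k. \<forall>m \<in> Poly_Mapping.keys f. weighted_degree d m = k)"

definition homogeneous_ideal :: "'k::field poly3 set \<Rightarrow> bool"
  where "homogeneous_ideal I \<longleftrightarrow>
    (\<exists>d :: nat ^ 3. (\<forall>i. d $ i > 0) \<and>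
      (\<exists>G. (\<forall>g\<in>G. homogeneous_poly d g) \<and> I = ideal_gen G))"

text \<open>
  The supremum of the lengths \<open>n\<close> of chains \<open>P\<^sub>0 \<subset> \<dots> \<subset> P\<^sub>n\<close> of prime ideals; it is \<open>-\<infinity>\<close> for the
  zero ring.
\<close>

definition krull_dim :: "('a, 'b) ring_scheme \<Rightarrow> ereal"
  where "krull_dim R =
    Sup {ereal (real n) | n. \<exists>P :: nat \<Rightarrow> 'a set.
      (\<forall>i\<le>n. primeideal (P i) R) \<and> (\<forall>i<n. P i \<subset> P (Suc i))}"

definition ideal_dim :: "'k::field poly3 set \<Rightarrow> ereal"
  where "ideal_dim I = krull_dim (S Quot I)"


text \<open>Entry \<open>L $ i $ j\<close> is in row \<open>i\<close> and column \<open>j\<close>; the vector \<open>1\<close> is \<open>(1, 1, 1)\<close>.\<close>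

definition CB_matrix :: "int ^ 3 ^ 3 \<Rightarrow> bool"
  where "CB_matrix L \<longleftrightarrow>
    (\<forall>i. L $ i $ i > 0) \<and>
    (\<forall>i j. i \<noteq> j \<longrightarrow> L $ i $ j \<le> 0) \<and>
    (\<forall>j. \<exists>i. i \<noteq> j \<and> L $ i $ j \<noteq> 0) \<and>
    L *v 1 = 0"

definition CB_ideal :: "'k::field poly3 set \<Rightarrow> bool"
  where "CB_ideal I \<longleftrightarrow>
    (\<exists>L :: int ^ 3 ^ 3. CB_matrix L \<and> I = ideal_gen {binomial (column i L) | i. True})"

end

theory Submission
  imports Defs
begin

text \<open>
  A CB matrix \<open>L\<close> is the Laplacian of a strongly connected digraph on three vertices, and its
  columns generate the lattice \<open>\<L> = L \<int>\<^sup>3\<close>.  If \<open>D - D' = L n\<close> with \<open>D, D' \<in> \<nat>\<^sup>3\<close>, then firing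
  successively the vertices where \<open>n\<close> is largest leads from \<open>D\<close> to \<open>D'\<close> inside \<open>\<nat>\<^sup>3\<close>, and every
  firing is a multiple of some \<open>f\<^sub>i\<close>; so \<open>I(L) = I(\<L>)\<close>.  The cross product of the first two columns
  is a positive weight \<open>d\<close> orthogonal to \<open>\<L>\<close>, and modulo \<open>I\<close> the polynomials of weighted degree at
  most \<open>e\<close> span a space of dimension \<open>O(e)\<close>, which excludes chains of three primes above \<open>I\<close>.

  Conversely, homogeneity forces \<open>\<L>\<close> to be orthogonal to a positive \<open>d\<close>.  If \<open>\<L>\<close> has rank at most
  one, kernels of monomial substitutions form a chain of three primes above \<open>I(\<L>)\<close>.  If it has rank
  two, a Euclidean descent on a basis yields the columns of a CB matrix.
\<close>

subsection \<open>Ideals of the polynomial ring\<close>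

lemma type_algebra_simps:
  fixes x y :: "'a::comm_ring_1"
  shows "carrier (ring_of_type_algebra :: 'a ring) = UNIV"
    "x \<otimes>\<^bsub>ring_of_type_algebra\<^esub> y = x * y" "x \<oplus>\<^bsub>ring_of_type_algebra\<^esub> y = x + y"
    "\<zero>\<^bsub>ring_of_type_algebra :: 'a ring\<^esub> = 0" "\<one>\<^bsub>ring_of_type_algebra :: 'a ring\<^esub> = 1"
  by (simp_all add: ring_of_type_algebra_def)

lemma cring_S: "cring (S :: 'k::field poly3 ring)"
  by (rule cring_from_type_algebra)

lemma type_algebra_a_inv: "\<ominus>\<^bsub>ring_of_type_algebra\<^esub> x = - x" for x :: "'a::comm_ring_1"
proof -
  interpret cring "ring_of_type_algebra :: 'a ring" by (rule cring_from_type_algebra)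
  show ?thesis
    by (rule minus_equality) (auto simp: type_algebra_simps)
qed

lemma additive_subgroup_type_algebra_iff:
  fixes H :: "'a::comm_ring_1 set"
  shows "additive_subgroup H ring_of_type_algebra \<longleftrightarrow>
    0 \<in> H \<and> (\<forall>x\<in>H. \<forall>y\<in>H. x + y \<in> H) \<and> (\<forall>x\<in>H. - x \<in> H)" (is "_ \<longleftrightarrow> ?rhs")
proof -
  interpret cring "ring_of_type_algebra :: 'a ring" by (rule cring_from_type_algebra)
  show ?thesis
  proof
    assume "additive_subgroup H ring_of_type_algebra"
    then interpret H: additive_subgroup H "ring_of_type_algebra :: 'a ring" .
    have "\<ominus>\<^bsub>ring_of_type_algebra\<^esub> x \<in> H" if "x \<in> H" for x
      using H.a_inv_closed[OF that] .
    then show ?rhs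
      using H.zero_closed H.a_closed unfolding type_algebra_simps type_algebra_a_inv by blast
  next
    assume H: ?rhs
    then have "\<ominus>\<^bsub>ring_of_type_algebra\<^esub> x \<in> H" if "x \<in> H" for x
      using that unfolding type_algebra_a_inv by blast
    then show "additive_subgroup H ring_of_type_algebra"
    proof (intro additive_subgroupI add.subgroupI)
      show "H \<noteq> {}" "H \<subseteq> carrier ring_of_type_algebra" using H by (auto simp: type_algebra_simps)
      show "x \<oplus>\<^bsub>ring_of_type_algebra\<^esub> y \<in> H" if "x \<in> H" "y \<in> H" for x y
        using H that by (simp add: type_algebra_simps)
    qed
  qed
qed

text \<open>All later work with ideals goes through this form, stated in the type class operations.
  Negatives come for free as multiples by \<open>- 1\<close>.\<close>

lemma ideal_S_iff:
  fixes J :: "'k::field poly3 set"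
  shows "ideal J S \<longleftrightarrow> 0 \<in> J \<and> (\<forall>x\<in>J. \<forall>y\<in>J. x + y \<in> J) \<and> (\<forall>x\<in>J. \<forall>r. r * x \<in> J)"
    (is "_ \<longleftrightarrow> ?rhs")
proof
  assume "ideal J S"
  then interpret ideal J "S :: 'k poly3 ring" .
  show ?rhs
    using additive_subgroup.zero_closed[OF additive_subgroup_axioms]
      additive_subgroup.a_closed[OF additive_subgroup_axioms] I_l_closed
    by (auto simp: type_algebra_simps)
next
  assume J: ?rhs
  interpret cring "S :: 'k poly3 ring" by (rule cring_S)
  have "- x \<in> J" if "x \<in> J" for x
  proof -
    have "(- 1) * x \<in> J" using J that by blast
    then show ?thesis by simp
  qed
  then have "additive_subgroup J S"
    using J unfolding additive_subgroup_type_algebra_iff by blast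
  then show "ideal J S"
    using J by (intro idealI additive_subgroup.a_subgroup) (auto simp: type_algebra_simps ring_axioms mult.commute)
qed

lemma ideal_uminus: "ideal J S \<Longrightarrow> x \<in> J \<Longrightarrow> - x \<in> J"
  for x :: "'k::field poly3"
  using ideal_S_iff[of J] mult_minus1[of x] by metis

lemma ideal_diff: "ideal J S \<Longrightarrow> x \<in> J \<Longrightarrow> y \<in> J \<Longrightarrow> x - y \<in> J"
  for x :: "'k::field poly3"
  using ideal_S_iff[of J] ideal_uminus[of J y] add_uminus_conv_diff[of x y] by metis

lemma ideal_sum: "ideal J S \<Longrightarrow> (\<And>i. i \<in> A \<Longrightarrow> f i \<in> J) \<Longrightarrow> sum f A \<in> J"
  for f :: "'i \<Rightarrow> 'k::field poly3"
  by (induction A rule: infinite_finite_induct) (auto simp: ideal_S_iff)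

lemma ideal_gen_ideal: "ideal (ideal_gen G) (S :: 'k::field poly3 ring)"
proof -
  interpret cring "S :: 'k poly3 ring" by (rule cring_S)
  show ?thesis by (rule genideal_ideal) (simp add: type_algebra_simps)
qed

lemma ideal_gen_subset_iff:
  fixes J :: "'k::field poly3 set"
  assumes "ideal J S"
  shows "ideal_gen G \<subseteq> J \<longleftrightarrow> G \<subseteq> J"
proof -
  interpret cring "S :: 'k poly3 ring" by (rule cring_S)
  show ?thesis
    using genideal_minimal[OF assms, of G] genideal_self[of G] by (auto simp: type_algebra_simps)
qed

lemma ideal_gen_superset: "G \<subseteq> ideal_gen (G :: 'k::field poly3 set)"
  using ideal_gen_subset_iff[OF ideal_gen_ideal] by blast

lemma primeideal_S_iff:
  fixes P :: "'k::field poly3 set"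
  shows "primeideal P S \<longleftrightarrow> ideal P S \<and> 1 \<notin> P \<and> (\<forall>x y. x * y \<in> P \<longrightarrow> x \<in> P \<or> y \<in> P)"
    (is "_ \<longleftrightarrow> ?rhs")
proof
  assume "primeideal P S"
  then interpret primeideal P "S :: 'k poly3 ring" .
  have "1 \<notin> P"
    using I_notcarr one_imp_carrier by (auto simp: type_algebra_simps)
  then show ?rhs
    using I_prime is_ideal by (auto simp: type_algebra_simps)
next
  assume ?rhs
  then show "primeideal P S"
    by (intro primeidealI cring_S) (auto simp: type_algebra_simps)
qed

subsection \<open>Chains of primes above an ideal\<close>

text \<open>The correspondence theorem for the projection onto \<open>S Quot I\<close>: preimages
  and images of primes are prime, and strict inclusions stay strict both ways. Later dimension
  arguments can then remain inside \<open>S\<close>.\<close>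

lemma prime_chain_quot_iff:
  fixes I :: "'k::field poly3 set"
  assumes I: "ideal I S"
  shows "(\<exists>P. (\<forall>i\<le>n. primeideal (P i) (S Quot I)) \<and> (\<forall>i<n. P i \<subset> P (Suc i))) \<longleftrightarrow>
    (\<exists>Q. (\<forall>i\<le>n. primeideal (Q i) S \<and> I \<subseteq> Q i) \<and> (\<forall>i<n. Q i \<subset> Q (Suc i)))"
    (is "?lhs = ?rhs")
proof -
  interpret I: ideal I "S :: 'k poly3 ring" by (rule I)
  interpret cring "S :: 'k poly3 ring" by (rule cring_S)
  interpret h: ring_hom_ring "S :: 'k poly3 ring" "S Quot I" "(+>\<^bsub>S\<^esub>) I"
    by (rule I.rcos_ring_hom_ring)
  have carr: "carrier (S Quot I) = range ((+>\<^bsub>S\<^esub>) I)"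
    by (auto simp: FactRing_def A_RCOSETS_def' type_algebra_simps)
  show ?thesis
  proof
    assume ?lhs
    then obtain P where P: "\<And>i. i \<le> n \<Longrightarrow> primeideal (P i) (S Quot I)"
      and lt: "\<And>i. i < n \<Longrightarrow> P i \<subset> P (Suc i)" by blast
    define Q where "Q i = {x. I +>\<^bsub>S\<^esub> x \<in> P i}" for i
    \<comment> \<open>The projection is onto, so \<open>Q i\<close> determines \<open>P i\<close>;
      hence the pulled back inclusions remain strict.\<close>
    have P_eq: "P i = (+>\<^bsub>S\<^esub>) I ` Q i" if "i \<le> n" for i
    proof -
      interpret p: primeideal "P i" "S Quot I" by (rule P[OF that])
      show ?thesis using p.a_subset unfolding carr Q_def by auto
    qed
    have "primeideal (Q i) S \<and> I \<subseteq> Q i" if "i \<le> n" for i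
    proof
      interpret p: primeideal "P i" "S Quot I" by (rule P[OF that])
      show "primeideal (Q i) S"
        using h.primeideal_vimage[OF cring_S P[OF that]] unfolding Q_def type_algebra_simps by simp
      show "I \<subseteq> Q i"
      proof
        fix x assume "x \<in> I"
        then have "I +>\<^bsub>S\<^esub> x = \<zero>\<^bsub>S Quot I\<^esub>"
          unfolding FactRing_def using I.a_rcos_const by simp
        then show "x \<in> Q i" unfolding Q_def
          using additive_subgroup.zero_closed[OF p.additive_subgroup_axioms] by simp
      qed
    qed
    moreover have "Q i \<subset> Q (Suc i)" if "i < n" for i
    proof -
      have "Q i \<subseteq> Q (Suc i)" using lt[OF that] by (auto simp: Q_def)
      moreover have "Q i \<noteq> Q (Suc i)"
        using lt[OF that] P_eq[of i] P_eq[of "Suc i"] that by auto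
      ultimately show ?thesis by blast
    qed
    ultimately show ?rhs by blast
  next
    assume ?rhs
    then obtain Q where Q: "\<And>i. i \<le> n \<Longrightarrow> primeideal (Q i) S" "\<And>i. i \<le> n \<Longrightarrow> I \<subseteq> Q i"
      and lt: "\<And>i. i < n \<Longrightarrow> Q i \<subset> Q (Suc i)" by blast
    define P where "P i = (+>\<^bsub>S\<^esub>) I ` Q i" for i
    \<comment> \<open>As \<open>I \<subseteq> Q i\<close>, membership of a coset in the image can be
      tested on any representative.\<close>
    have mem: "I +>\<^bsub>S\<^esub> x \<in> P i \<longleftrightarrow> x \<in> Q i" if "i \<le> n" for i x
    proof
      assume "I +>\<^bsub>S\<^esub> x \<in> P i"
      then obtain y where y: "y \<in> Q i" "I +>\<^bsub>S\<^esub> x = I +>\<^bsub>S\<^esub> y" by (auto simp: P_def)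
      have id: "ideal (Q i) S" using Q(1)[OF that] by (simp add: primeideal_S_iff)
      have "x \<in> I +>\<^bsub>S\<^esub> y"
        using I.a_rcos_self[of x] unfolding y(2) by (simp add: type_algebra_simps)
      then obtain z where z: "z \<in> I" "x = z + y"
        unfolding a_r_coset_def' by (auto simp: type_algebra_simps)
      then show "x \<in> Q i"
        using Q(2)[OF that] y(1) id by (auto simp: ideal_S_iff)
    qed (auto simp: P_def)
    have qr: "cring (S Quot I)" by (rule I.quotient_is_cring[OF cring_S])
    have "primeideal (P i) (S Quot I)" if "i \<le> n" for i
    proof (rule primeidealI[OF _ qr])
      have pr: "primeideal (Q i) S" by (rule Q(1)[OF that])
      show "ideal (P i) (S Quot I)"
        unfolding P_def by (rule I.ring_ideal_imp_quot_ideal[OF I]) (use pr in \<open>simp add: primeideal_S_iff\<close>)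
      show "carrier (S Quot I) \<noteq> P i"
        using mem[OF that, of 1] pr by (auto simp: carr primeideal_S_iff)
      fix a b assume "a \<in> carrier (S Quot I)" "b \<in> carrier (S Quot I)"
        and ab: "a \<otimes>\<^bsub>S Quot I\<^esub> b \<in> P i"
      then obtain x y where xy: "a = I +>\<^bsub>S\<^esub> x" "b = I +>\<^bsub>S\<^esub> y" by (auto simp: carr)
      have "I +>\<^bsub>S\<^esub> (x * y) \<in> P i"
        using ab xy h.hom_mult[of x y] by (simp add: type_algebra_simps)
      then show "a \<in> P i \<or> b \<in> P i"
        using mem[OF that] pr by (auto simp: xy primeideal_S_iff)
    qed
    moreover have "P i \<subset> P (Suc i)" if "i < n" for i
    proof -
      have "P i \<subseteq> P (Suc i)" using lt[OF that] by (auto simp: P_def)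
      moreover obtain x where "x \<in> Q (Suc i)" "x \<notin> Q i" using lt \<open>i < n\<close> by blast
      then have "I +>\<^bsub>S\<^esub> x \<in> P (Suc i)" "I +>\<^bsub>S\<^esub> x \<notin> P i"
        using mem[of i x] mem[of "Suc i" x] that by auto
      ultimately show ?thesis by blast
    qed
    ultimately show ?lhs by blast
  qed
qed

lemma ideal_dim_eq_Sup:
  fixes I :: "'k::field poly3 set"
  assumes "ideal I S"
  shows "ideal_dim I = Sup {ereal (real n) | n. \<exists>Q.
    (\<forall>i\<le>n. primeideal (Q i) S \<and> I \<subseteq> Q i) \<and> (\<forall>i<n. Q i \<subset> Q (Suc i))}"
  unfolding ideal_dim_def krull_dim_def prime_chain_quot_iff[OF assms] ..

subsection \<open>Monomial substitutions\<close>

lemma poly_mapping_sum_single: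
  "f = (\<Sum>m\<in>Poly_Mapping.keys f. Poly_Mapping.single m (Poly_Mapping.lookup f m))"
proof (rule poly_mapping_eqI)
  fix k
  show "Poly_Mapping.lookup f k =
    Poly_Mapping.lookup (\<Sum>m\<in>Poly_Mapping.keys f. Poly_Mapping.single m (Poly_Mapping.lookup f m)) k"
    by (simp add: lookup_sum lookup_single when_def in_keys_iff)
qed

lemma weighted_degree_0 [simp]: "weighted_degree d 0 = 0" "weighted_degree 0 m = 0"
  by (simp_all add: weighted_degree_def)

lemma weighted_degree_add: "weighted_degree d (m + n) = weighted_degree d m + weighted_degree d n"
  by (simp add: weighted_degree_def sum.distrib algebra_simps)

lemma weighted_degree_axis [simp]: "weighted_degree d (axis i c) = vec_nth d i * c"
  by (simp add: weighted_degree_def axis_def if_distrib cong: if_cong)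

lemma weighted_degree_pos_neg_part:
  fixes d :: "nat ^ 3" and a :: "int ^ 3"
  shows "int (weighted_degree d (pos_part a)) - int (weighted_degree d (neg_part a)) = (\<Sum>i\<in>UNIV. int (d $ i) * a $ i)"
proof -
  have "int (nat x) - int (nat (- x)) = x" for x :: int by simp
  then show ?thesis
    by (simp add: weighted_degree_def pos_part_def neg_part_def flip: sum_subtractf right_diff_distrib)
qed

text \<open>The substitution homomorphism sending the i-th variable to x^(p $ i) y^(q $ i). The
  coefficients are polynomials in y, so x = 0 and then y = 0 are two applications of
  \<open>poly\<close>; with \<open>q = 0\<close> only the grading by \<open>p\<close> is
  recorded.\<close>

definition ev :: "nat ^ 3 \<Rightarrow> nat ^ 3 \<Rightarrow> 'k::field poly3 \<Rightarrow> 'k poly poly"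
  where "ev p q f = (\<Sum>m\<in>Poly_Mapping.keys f. Polynomial.monom
    (Polynomial.monom (Poly_Mapping.lookup f m) (weighted_degree q m)) (weighted_degree p m))"

lemma ev_superset:
  assumes "finite A" "Poly_Mapping.keys f \<subseteq> A"
  shows "ev p q f = (\<Sum>m\<in>A. Polynomial.monom
    (Polynomial.monom (Poly_Mapping.lookup f m) (weighted_degree q m)) (weighted_degree p m))"
  unfolding ev_def by (rule sum.mono_neutral_left) (use assms in \<open>auto simp: in_keys_iff\<close>)

lemma ev_add: "ev p q (f + g) = ev p q f + ev p q g"
proof -
  let ?A = "Poly_Mapping.keys f \<union> Poly_Mapping.keys g"
  have "Poly_Mapping.keys (f + g) \<subseteq> ?A" by (rule Poly_Mapping.keys_add)
  then show ?thesis
    by (simp add: ev_superset[of ?A] lookup_add sum.distrib flip: add_monom)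
qed

lemma ev_0 [simp]: "ev p q 0 = 0"
  by (simp add: ev_def)

lemma ev_sum: "ev p q (sum f A) = (\<Sum>i\<in>A. ev p q (f i))"
  by (induction A rule: infinite_finite_induct) (simp_all add: ev_add)

lemma ev_single:
  "ev p q (Poly_Mapping.single m c) =
    Polynomial.monom (Polynomial.monom c (weighted_degree q m)) (weighted_degree p m)"
  by (simp add: ev_def)

lemma ev_1 [simp]: "ev p q 1 = 1"
  using ev_single[of p q 0 1] by (simp add: monom_0 one_pCons)

lemma ev_mult: "ev p q (f * g) = ev p q f * ev p q g"
proof -
  let ?s = "\<lambda>f m. Poly_Mapping.single m (Poly_Mapping.lookup f m)"
  have "f * g = (\<Sum>m\<in>Poly_Mapping.keys f. \<Sum>n\<in>Poly_Mapping.keys g. ?s f m * ?s g n)"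
    by (subst poly_mapping_sum_single[of f], subst poly_mapping_sum_single[of g], rule sum_product)
  then have "ev p q (f * g) =
      (\<Sum>m\<in>Poly_Mapping.keys f. \<Sum>n\<in>Poly_Mapping.keys g. ev p q (?s f m) * ev p q (?s g n))"
    by (simp add: ev_sum Poly_Mapping.mult_single ev_single mult_monom weighted_degree_add)
  also have "\<dots> = (\<Sum>m\<in>Poly_Mapping.keys f. ev p q (?s f m)) * (\<Sum>n\<in>Poly_Mapping.keys g. ev p q (?s g n))"
    by (rule sum_product[symmetric])
  also have "\<dots> = ev p q f * ev p q g"
    by (simp flip: ev_sum poly_mapping_sum_single)
  finally show ?thesis .
qed

lemma ev_uminus: "ev p q (- f) = - ev p q f"
  using ev_add[of p q f "- f"] by (simp add: eq_neg_iff_add_eq_0 add.commute)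

lemma ev_diff: "ev p q (f - g) = ev p q f - ev p q g"
  using ev_add[of p q f "- g"] by (simp add: ev_uminus)

lemma ev_monomial:
  "ev p q (monomial m) = Polynomial.monom (Polynomial.monom 1 (weighted_degree q m)) (weighted_degree p m)"
  by (simp add: monomial_def ev_single)

lemma hom_kernel_primeideal:
  fixes \<phi> :: "'k::field poly3 \<Rightarrow> 'r::idom"
  assumes "\<phi> 1 = 1" "\<And>f g. \<phi> (f + g) = \<phi> f + \<phi> g" "\<And>f g. \<phi> (f * g) = \<phi> f * \<phi> g"
  shows "primeideal {f. \<phi> f = 0} S"
proof -
  have "\<phi> 0 = 0" by (metis add_cancel_right_left add_0 assms(2))
  then show ?thesis by (auto simp: primeideal_S_iff ideal_S_iff assms)
qed

text \<open>The kernels of \<open>t\<^sub>i \<mapsto> x\<^bsup>p i\<^esup> y\<^bsup>q i\<^esup>\<close> and of its compositions with \<open>x \<mapsto> 0\<close> and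
  with \<open>x, y \<mapsto> 0\<close>; \<open>x\<close> is the outer variable of \<open>K[y][x]\<close>.\<close>

definition ker_xy :: "nat ^ 3 \<Rightarrow> nat ^ 3 \<Rightarrow> 'k::field poly3 set"
  where "ker_xy p q = {f. ev p q f = 0}"

definition ker_y :: "nat ^ 3 \<Rightarrow> nat ^ 3 \<Rightarrow> 'k::field poly3 set"
  where "ker_y p q = {f. poly (ev p q f) 0 = 0}"

definition ker_pt :: "nat ^ 3 \<Rightarrow> nat ^ 3 \<Rightarrow> 'k::field poly3 set"
  where "ker_pt p q = {f. poly (poly (ev p q f) 0) 0 = 0}"

lemma primeideal_ker:
  "primeideal (ker_xy p q :: 'k::field poly3 set) S"
  "primeideal (ker_y p q :: 'k::field poly3 set) S"
  "primeideal (ker_pt p q :: 'k::field poly3 set) S"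
  unfolding ker_xy_def ker_y_def ker_pt_def
  by (rule hom_kernel_primeideal; simp add: ev_add ev_mult)+

text \<open>The i-th variable goes to a monomial divisible by x: non-zero, but killed by x =
  0.\<close>

lemma ker_xy_psubset_ker_y:
  fixes p q :: "nat ^ 3"
  assumes "p $ i > 0"
  shows "ker_xy p q \<subset> (ker_y p q :: 'k::field poly3 set)"
proof -
  have "monomial (axis i 1) \<in> (ker_y p q :: 'k poly3 set) - ker_xy p q"
    using assms by (simp add: ker_y_def ker_xy_def ev_monomial poly_monom)
  moreover have "ker_xy p q \<subseteq> (ker_y p q :: 'k poly3 set)"
    by (auto simp: ker_y_def ker_xy_def)
  ultimately show ?thesis by blast
qed

text \<open>Here the i-th variable goes to a pure power of y, which survives x = 0 and vanishes only
  at y = 0.\<close>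

lemma ker_y_psubset_ker_pt:
  fixes p q :: "nat ^ 3"
  assumes "p $ i = 0" "q $ i > 0"
  shows "ker_y p q \<subset> (ker_pt p q :: 'k::field poly3 set)"
proof -
  have "monomial (axis i 1) \<in> (ker_pt p q :: 'k poly3 set) - ker_y p q"
    using assms by (simp add: ker_y_def ker_pt_def ev_monomial poly_monom)
  moreover have "ker_y p q \<subseteq> (ker_pt p q :: 'k poly3 set)"
    by (auto simp: ker_y_def ker_pt_def)
  ultimately show ?thesis by blast
qed

text \<open>A difference of two monomials is zero exactly when their exponents agree. Weights
  orthogonal to a lattice thus put its lattice ideal inside the prime
  \<open>ker_xy p q\<close>.\<close>

lemma ev_binomial_eq_0_iff:
  fixes p q :: "nat ^ 3" and a :: "int ^ 3"
  shows "ev p q (binomial a :: 'k::field poly3) = 0 \<longleftrightarrow>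
    (\<Sum>i\<in>UNIV. int (p $ i) * a $ i) = 0 \<and> (\<Sum>i\<in>UNIV. int (q $ i) * a $ i) = 0"
proof -
  have "ev p q (binomial a :: 'k poly3) = 0 \<longleftrightarrow>
      weighted_degree p (pos_part a) = weighted_degree p (neg_part a) \<and>
      weighted_degree q (pos_part a) = weighted_degree q (neg_part a)"
    by (auto simp: binomial_def ev_diff ev_monomial monom_eq_iff')
  then show ?thesis
    by (simp flip: weighted_degree_pos_neg_part)
qed

subsection \<open>Homogeneity\<close>

text \<open>A homogeneous polynomial goes to a scalar multiple of a single power of x, and the
  scalar is the value at x = 1.\<close>

lemma ev_homogeneous:
  assumes "homogeneous_poly d g" "poly (ev d 0 g) 1 = 0"
  shows "ev d 0 g = 0"
proof -
  obtain k where "\<forall>m\<in>Poly_Mapping.keys g. weighted_degree d m = k"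
    using assms(1) by (auto simp: homogeneous_poly_def)
  then have "ev d 0 g = Polynomial.monom (\<Sum>m\<in>Poly_Mapping.keys g.
      Polynomial.monom (Poly_Mapping.lookup g m) 0) k"
    by (simp add: ev_def monom_sum)
  then show ?thesis using assms(2) by (simp add: poly_monom)
qed

text \<open>Setting all variables to 1 kills every binomial, hence also the generators in
  \<open>G\<close>. Being homogeneous, these already vanish under the substitution with exponents
  \<open>d\<close>. So the whole ideal lies in \<open>ker_xy d 0\<close>, in particular the
  binomials of the lattice.\<close>

lemma homogeneous_lattice_orthogonal:
  fixes G :: "'k::field poly3 set" and d :: "nat ^ 3" and \<L> :: "(int ^ 3) set"
  assumes eq: "ideal_gen (binomial ` \<L>) = ideal_gen G"
    and G: "\<And>g. g \<in> G \<Longrightarrow> homogeneous_poly d g" and a: "a \<in> \<L>"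
  shows "(\<Sum>i\<in>UNIV. int (d $ i) * a $ i) = 0"
proof -
  have "primeideal {f :: 'k poly3. poly (ev d 0 f) 1 = 0} S"
    by (rule hom_kernel_primeideal) (simp_all add: ev_add ev_mult)
  then have id: "ideal {f :: 'k poly3. poly (ev d 0 f) 1 = 0} S"
    by (simp add: primeideal_S_iff)
  have "binomial ` \<L> \<subseteq> {f :: 'k poly3. poly (ev d 0 f) 1 = 0}"
    by (auto simp: binomial_def ev_diff ev_monomial poly_monom monom_0)
  then have "G \<subseteq> {f. poly (ev d 0 f) 1 = 0}"
    using ideal_gen_subset_iff[OF id, of "binomial ` \<L>"] ideal_gen_superset[of G] eq by auto
  then have "G \<subseteq> ker_xy d 0"
    using G ev_homogeneous by (auto simp: ker_xy_def)
  then have "ideal_gen (binomial ` \<L>) \<subseteq> (ker_xy d 0 :: 'k poly3 set)"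
    unfolding eq using ideal_gen_subset_iff primeideal_ker(1) primeideal_S_iff by blast
  then have "binomial a \<in> (ker_xy d 0 :: 'k poly3 set)"
    using a ideal_gen_superset by blast
  then show ?thesis by (simp add: ker_xy_def ev_binomial_eq_0_iff)
qed

lemma homogeneous_ideal_if_orthogonal:
  fixes d :: "nat ^ 3" and A :: "(int ^ 3) set"
  assumes "\<And>i. d $ i > 0" "\<And>a. a \<in> A \<Longrightarrow> (\<Sum>i\<in>UNIV. int (d $ i) * a $ i) = 0"
  shows "homogeneous_ideal (ideal_gen (binomial ` A) :: 'k::field poly3 set)"
proof -
  have "homogeneous_poly d (binomial a :: 'k poly3)" if "a \<in> A" for a
  proof -
    have "weighted_degree d (pos_part a) = weighted_degree d (neg_part a)"
      using weighted_degree_pos_neg_part[of d a] assms(2)[OF that] by simp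
    moreover have "Poly_Mapping.keys (binomial a :: 'k poly3) \<subseteq> {pos_part a, neg_part a}"
      unfolding binomial_def monomial_def by (rule order_trans[OF keys_diff]) auto
    ultimately show ?thesis unfolding homogeneous_poly_def by blast
  qed
  then show ?thesis unfolding homogeneous_ideal_def using assms(1) by blast
qed

subsection \<open>Chip firing\<close>

lemma monomial_add: "monomial (m + n) = (monomial m * monomial n :: 'k::field poly3)"
  by (simp add: monomial_def Poly_Mapping.mult_single)

text \<open>The difference is a monomial multiple of the binomial, the cofactor being the common
  part of \<open>D\<close> and \<open>D'\<close>.\<close>

lemma monomial_diff_mem:
  fixes J :: "'k::field poly3 set" and D D' :: "nat ^ 3"
  assumes J: "ideal J S" and a: "binomial a \<in> J" and D: "\<And>i. int (D $ i) - int (D' $ i) = a $ i"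
  shows "monomial D - monomial D' \<in> J"
proof -
  \<comment> \<open>The natural subtraction is exact: \<open>D'\<close> is non-negative, so
    \<open>D $ i\<close> is at least \<open>a $ i\<close>.\<close>
  define m where "m = (\<chi> i. D $ i - pos_part a $ i)"
  have "D $ i = (D $ i - nat (a $ i)) + nat (a $ i) \<and> D' $ i = (D $ i - nat (a $ i)) + nat (- a $ i)" for i
    using D[of i] by linarith
  then have "D = m + pos_part a" "D' = m + neg_part a"
    by (simp_all add: vec_eq_iff m_def pos_part_def neg_part_def)
  then have "monomial D - monomial D' = monomial m * (binomial a :: 'k poly3)"
    by (simp add: monomial_add binomial_def right_diff_distrib)
  then show ?thesis using J a by (simp add: ideal_S_iff)
qed

lemma ex_3: "(\<exists>k :: 3. P k) \<longleftrightarrow> P 1 \<or> P 2 \<or> P 3"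
  by (metis exhaust_3)

lemma matrix_vector_mult_axis: "A *v axis k 1 = column k A" for A :: "int ^ 'n ^ 'm"
  by (simp add: vec_eq_iff column_def matrix_vector_mult_def axis_def if_distrib cong: if_cong)

text \<open>A vertex with strictly the largest entry of \<open>n\<close> can be fired without leaving \<open>\<nat>\<^sup>3\<close>.\<close>

lemma CB_matrix_fire:
  fixes D D' :: "nat ^ 3" and n :: "int ^ 3"
  assumes L: "CB_matrix L" and D: "\<And>i. int (D $ i) - int (D' $ i) = (L *v n) $ i"
    and k: "\<And>j. j \<noteq> k \<Longrightarrow> n $ j < n $ k"
  shows "\<exists>E :: nat ^ 3. (\<forall>i. int (D $ i) - int (E $ i) = column k L $ i) \<and>
    (\<forall>i. int (E $ i) - int (D' $ i) = (L *v (n - axis k 1)) $ i)"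
proof -
  have row: "(\<Sum>j\<in>UNIV. L $ i $ j) = 0" for i
  proof -
    have "(L *v 1) $ i = 0" using L by (simp add: CB_matrix_def)
    then show ?thesis by (simp add: matrix_vector_mult_def)
  qed
  \<comment> \<open>Row sums are zero, so subtracting \<open>n $ k - 1\<close> from every entry of
    \<open>n\<close> leaves \<open>L *v n\<close> unchanged. Afterwards the entry at
    \<open>k\<close> is 1 and the others are at most 0, so the off-diagonal terms of row
    \<open>k\<close> are non-negative and vertex \<open>k\<close> holds at least
    \<open>L $ k $ k\<close>. The other vertices only gain.\<close>
  have nonneg: "L $ i $ k \<le> int (D $ i)" for i
  proof (cases "i = k")
    case True
    have "(\<Sum>j\<in>UNIV. L $ k $ j * (n $ j - n $ k + 1)) =
        (\<Sum>j\<in>UNIV. L $ k $ j * n $ j) - (n $ k - 1) * (\<Sum>j\<in>UNIV. L $ k $ j)"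
      unfolding sum_distrib_left sum_subtractf[symmetric] by (rule sum.cong) (simp_all add: algebra_simps)
    then have "(L *v n) $ k = (\<Sum>j\<in>UNIV. L $ k $ j * (n $ j - n $ k + 1))"
      using row[of k] by (simp add: matrix_vector_mult_def)
    also have "\<dots> = L $ k $ k + (\<Sum>j\<in>UNIV - {k}. L $ k $ j * (n $ j - n $ k + 1))"
      by (subst sum.remove[of _ k]) auto
    also have "\<dots> \<ge> L $ k $ k"
    proof -
      have "0 \<le> L $ k $ j * (n $ j - n $ k + 1)" if "j \<noteq> k" for j
        using k[OF that] L that by (intro mult_nonpos_nonpos) (auto simp: CB_matrix_def)
      then have "0 \<le> (\<Sum>j\<in>UNIV - {k}. L $ k $ j * (n $ j - n $ k + 1))"
        by (intro sum_nonneg) auto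
      then show ?thesis by simp
    qed
    finally show ?thesis unfolding True using D[of k] by linarith
  next
    case False
    then have "L $ i $ k \<le> 0" using L by (simp add: CB_matrix_def)
    then show ?thesis by linarith
  qed
  define E where "E = (\<chi> i. nat (int (D $ i) - L $ i $ k))"
  have E: "int (E $ i) = int (D $ i) - L $ i $ k" for i
    using nonneg[of i] by (simp add: E_def)
  show ?thesis
  proof (intro exI[of _ E] conjI allI)
    show "int (D $ i) - int (E $ i) = column k L $ i" for i
      by (simp add: E column_def)
    show "int (E $ i) - int (D' $ i) = (L *v (n - axis k 1)) $ i" for i
      using D[of i] by (simp add: E matrix_vector_mult_diff_distrib matrix_vector_mult_axis column_def)
  qed
qed

text \<open>The termination measure for firing. Its invariance under negation lets a move be read
  backwards, with \<open>D\<close> and \<open>D'\<close> exchanged.\<close>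

definition spread :: "int ^ 3 \<Rightarrow> nat"
  where "spread n = nat (max (n $ 1) (max (n $ 2) (n $ 3)) - min (n $ 1) (min (n $ 2) (n $ 3)))"

lemma spread_uminus: "spread (- n) = spread n"
  by (simp add: spread_def flip: minus_min_eq_max minus_max_eq_min)

text \<open>Lowering a strict maximum by one lowers the maximum, and the new entry is still at least
  every other one, so the minimum does not drop.\<close>

lemma spread_fire:
  fixes n :: "int ^ 3"
  assumes "\<And>j. j \<noteq> k \<Longrightarrow> n $ j < n $ k"
  shows "spread (n - axis k 1) < spread n"
proof -
  define M m where "M n = max (n $ 1) (max (n $ 2) (n $ 3))" and "m n = min (n $ 1) (min (n $ 2) (n $ 3))"
    for n :: "int ^ 3"
  have M: "x < M n \<longleftrightarrow> x < n $ 1 \<or> x < n $ 2 \<or> x < n $ 3" "M n < x \<longleftrightarrow> n $ 1 < x \<and> n $ 2 < x \<and> n $ 3 < x"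
    and m: "m n \<le> x \<longleftrightarrow> n $ 1 \<le> x \<or> n $ 2 \<le> x \<or> n $ 3 \<le> x" "m n < x \<longleftrightarrow> n $ 1 < x \<or> n $ 2 < x \<or> n $ 3 < x"
    and m': "x \<le> m n \<longleftrightarrow> x \<le> n $ 1 \<and> x \<le> n $ 2 \<and> x \<le> n $ 3" for x and n :: "int ^ 3"
    unfolding M_def m_def
    by (simp_all only: less_max_iff_disj max_less_iff_conj min_le_iff_disj min_less_iff_disj min.bounded_iff)
  have "k = 1 \<or> k = 2 \<or> k = 3" using exhaust_3 by auto
  then have "M (n - axis k 1) < M n" "m n \<le> m (n - axis k 1)" "m n < M n"
    using assms[of 1] assms[of 2] assms[of 3] unfolding M m' m
    by (elim disjE; simp add: axis_def)+
  then show ?thesis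
    unfolding spread_def M_def[symmetric] m_def[symmetric] by linarith
qed

text \<open>Among three integers that are not all equal, the largest or the smallest occurs only
  once. A unique largest entry is fired; a unique smallest one becomes largest after negating
  \<open>n\<close>.\<close>

lemma CB_matrix_monomial_diff_mem:
  fixes J :: "'k::field poly3 set" and D D' :: "nat ^ 3"
  assumes L: "CB_matrix L" and J: "ideal J S" and f: "\<And>k. binomial (column k L) \<in> J"
  shows "(\<And>i. int (D $ i) - int (D' $ i) = (L *v n) $ i) \<Longrightarrow> monomial D - monomial D' \<in> J"
proof (induction "spread n" arbitrary: n D D' rule: less_induct)
  case less
  note D = less.prems
  \<comment> \<open>Stated for any \<open>m\<close> of the same spread, so that it covers both
    \<open>n\<close> and \<open>- n\<close>.\<close>
  have step: "monomial A - monomial B \<in> J"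
    if k: "\<And>j. j \<noteq> k \<Longrightarrow> m $ j < m $ k" and m: "spread m = spread n"
      and AB: "\<And>i. int (A $ i) - int (B $ i) = (L *v m) $ i"
    for k A B and m :: "int ^ 3"
  proof -
    obtain E where E: "\<And>i. int (A $ i) - int (E $ i) = column k L $ i"
      "\<And>i. int (E $ i) - int (B $ i) = (L *v (m - axis k 1)) $ i"
      using CB_matrix_fire[OF L AB k] by metis
    have "spread (m - axis k 1) < spread n"
      using spread_fire[of k m] k m by simp
    then have "monomial E - monomial B \<in> J"
      by (rule less.hyps[OF _ E(2)])
    moreover have "monomial A - monomial E \<in> J"
      by (rule monomial_diff_mem[OF J f E(1)])
    ultimately have "(monomial A - monomial E) + (monomial E - monomial B) \<in> J"
      using J unfolding ideal_S_iff by blast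
    then show ?thesis by simp
  qed
  have "(\<exists>k. \<forall>j. j \<noteq> k \<longrightarrow> n $ j < n $ k) \<or> (\<exists>k. \<forall>j. j \<noteq> k \<longrightarrow> n $ k < n $ j) \<or>
      n $ 1 = n $ 2 \<and> n $ 2 = n $ 3"
    unfolding ex_3 forall_3 by (simp, linarith)
  then show ?case
  proof (elim disjE exE conjE)
    fix k assume "\<forall>j. j \<noteq> k \<longrightarrow> n $ j < n $ k"
    then show ?thesis by (intro step[OF _ refl D, of k]) simp
  next
    fix k assume k: "\<forall>j. j \<noteq> k \<longrightarrow> n $ k < n $ j"
    have "int (D' $ i) - int (D $ i) = (L *v (- n)) $ i" for i
      using D[of i] by (simp add: matrix_vector_mult_def sum_negf)
    moreover have "(- n) $ j < (- n) $ k" if "j \<noteq> k" for j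
      using k that by simp
    ultimately have "monomial D' - monomial D \<in> J"
      by (intro step[of k "- n"] spread_uminus)
    then have "- (monomial D' - monomial D) \<in> J"
      by (rule ideal_uminus[OF J])
    then show ?thesis by simp
  next
    assume "n $ 1 = n $ 2" "n $ 2 = n $ 3"
    then have n: "n $ j = n $ 1" for j
      using exhaust_3[of j] by auto
    have "(L *v n) $ i = (L *v 1) $ i * n $ 1" for i
      unfolding matrix_vector_mult_def vec_lambda_beta sum_distrib_right
      by (rule sum.cong[OF refl], subst n) simp
    then have "(L *v n) $ i = 0" for i
      using L by (simp add: CB_matrix_def)
    then have "D = D'"
      using D by (simp add: vec_eq_iff)
    then show ?thesis using J by (simp add: ideal_S_iff)
  qed
qed

text \<open>Columns are images of unit vectors, which gives one inclusion; chip firing from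
  \<open>pos_part\<close> to \<open>neg_part\<close> of \<open>L *v n\<close> gives the
  other.\<close>

lemma CB_ideal_eq_lattice_ideal:
  assumes L: "CB_matrix L"
  shows "ideal_gen {binomial (column i L) | i. True} =
    (ideal_gen (binomial ` range ((*v) L)) :: 'k::field poly3 set)" (is "?J = ?I")
proof
  have "binomial (column i L) \<in> binomial ` range ((*v) L)" for i
    by (intro imageI range_eqI[of _ _ "axis i 1"]) (simp add: matrix_vector_mult_axis)
  then have "{binomial (column i L) | i. True} \<subseteq> (binomial ` range ((*v) L) :: 'k poly3 set)"
    by blast
  then show "?J \<subseteq> ?I"
    unfolding ideal_gen_subset_iff[OF ideal_gen_ideal] using ideal_gen_superset by (rule order_trans)
  have f: "binomial (column k L) \<in> ?J" for k
    by (rule subsetD[OF ideal_gen_superset]) blast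
  have "binomial (L *v n) \<in> ?J" for n
    unfolding binomial_def[of "L *v n"]
    by (rule CB_matrix_monomial_diff_mem[OF L ideal_gen_ideal f, where n = n])
      (simp add: pos_part_def neg_part_def)
  then show "?I \<subseteq> ?J"
    unfolding ideal_gen_subset_iff[OF ideal_gen_ideal] by blast
qed

subsection \<open>CB ideals are homogeneous of dimension one\<close>

text \<open>Gaussian elimination: each equation with a non-zero coefficient uses up one unknown, and
  there are more unknowns than equations.\<close>

lemma exists_nontrivial_relation:
  fixes r :: "'i \<Rightarrow> 'j \<Rightarrow> 'k::field"
  assumes "finite J" "finite A" "card J < card A"
  shows "\<exists>c. (\<exists>i\<in>A. c i \<noteq> 0) \<and> (\<forall>j\<in>J. (\<Sum>i\<in>A. c i * r i j) = 0)"
  using assms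
proof (induction J arbitrary: A r rule: finite_induct)
  case empty
  then obtain i where "i \<in> A" by fastforce
  then show ?case by (intro exI[of _ "\<lambda>_. 1"]) auto
next
  case (insert j J)
  show ?case
  proof (cases "\<exists>i\<in>A. r i j \<noteq> 0")
    case False
    have "\<exists>c. (\<exists>i\<in>A. c i \<noteq> 0) \<and> (\<forall>j\<in>J. (\<Sum>i\<in>A. c i * r i j) = 0)"
      using insert by (intro insert.IH) auto
    then show ?thesis using False by auto
  next
    case True
    then obtain p where p: "p \<in> A" "r p j \<noteq> 0" by blast
    define r' where "r' i l = r i l - r i j / r p j * r p l" for i l
    have "card J < card (A - {p})"
      using insert p by simp
    then obtain c where c: "\<exists>i\<in>A - {p}. c i \<noteq> 0" "\<forall>l\<in>J. (\<Sum>i\<in>A - {p}. c i * r' i l) = 0"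
      using insert.IH[of "A - {p}" r'] insert.prems by auto
    \<comment> \<open>The value of the pivot unknown that solves equation \<open>j\<close>; it turns
      the remaining equations into those for \<open>r'\<close>.\<close>
    define s where "s = - (\<Sum>i\<in>A - {p}. c i * (r i j / r p j))"
    define c' where "c' = c(p := s)"
    have *: "(\<Sum>i\<in>A. c' i * r i l) = (\<Sum>i\<in>A - {p}. c i * r' i l)" for l
    proof -
      have "(\<Sum>i\<in>A. c' i * r i l) = s * r p l + (\<Sum>i\<in>A - {p}. c i * r i l)"
        using p insert.prems by (subst sum.remove[of _ p]) (auto simp: c'_def intro!: sum.cong)
      also have "\<dots> = (\<Sum>i\<in>A - {p}. c i * r' i l)"
        by (simp add: s_def r'_def sum_distrib_left sum_distrib_right right_diff_distrib sum_subtractf mult_ac)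
      finally show ?thesis .
    qed
    have "r' i j = 0" for i
      using p by (simp add: r'_def)
    then have "(\<Sum>i\<in>A. c' i * r i l) = 0" if "l \<in> insert j J" for l
      using that c(2) by (auto simp: *)
    moreover have "\<exists>i\<in>A. c' i \<noteq> 0"
      using c(1) by (auto simp: c'_def)
    ultimately show ?thesis by blast
  qed
qed

text \<open>The power \<open>g ^ k\<close> can be cancelled modulo the prime \<open>P\<close>, and
  modulo \<open>Q\<close>, which contains \<open>g\<close>, only the lowest coefficient is
  left.\<close>

lemma prime_polynomial_relation:
  fixes P Q :: "'k::field poly3 set" and u :: "nat \<Rightarrow> 'k poly3"
  assumes P: "primeideal P S" and Q: "ideal Q S" and PQ: "P \<subseteq> Q" and g: "g \<in> Q" "g \<notin> P"
    and sum: "(\<Sum>i\<le>n. u i * g ^ i) \<in> P" and k: "k \<le> n" "\<And>i. i < k \<Longrightarrow> u i = 0"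
  shows "u k \<in> Q"
proof -
  have idP: "ideal P S" using P by (simp add: primeideal_S_iff)
  have "(\<Sum>i\<le>n. u i * g ^ i) = (\<Sum>i\<in>{k..n}. u i * g ^ i)"
    using k(2) by (intro sum.mono_neutral_right) auto
  also have "\<dots> = (\<Sum>i\<in>{k..n}. g ^ k * (u i * g ^ (i - k)))"
    by (rule sum.cong) (auto simp: algebra_simps simp flip: power_add)
  also have "\<dots> = g ^ k * (\<Sum>i\<in>{k..n}. u i * g ^ (i - k))"
    by (simp add: sum_distrib_left)
  finally have "g ^ k * (\<Sum>i\<in>{k..n}. u i * g ^ (i - k)) \<in> P"
    using sum by simp
  moreover have "g ^ k \<notin> P" for k
    using P g(2) by (induction k) (auto simp: primeideal_S_iff)
  ultimately have "(\<Sum>i\<in>{k..n}. u i * g ^ (i - k)) \<in> P"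
    using P unfolding primeideal_S_iff by blast
  then have sumQ: "(\<Sum>i\<in>{k..n}. u i * g ^ (i - k)) \<in> Q" using PQ by blast
  have "(\<Sum>i\<in>{k..n}. u i * g ^ (i - k)) = u k + (\<Sum>i\<in>{k<..n}. u i * g ^ (i - k))"
    using k(1) by (simp add: sum.head)
  moreover have "(\<Sum>i\<in>{k<..n}. u i * g ^ (i - k)) \<in> Q"
  proof (rule ideal_sum[OF Q])
    fix i assume "i \<in> {k<..n}"
    then have i: "i - k = Suc (i - k - 1)" unfolding greaterThanAtMost_iff by linarith
    have "u i * g ^ (i - k) = (u i * g ^ (i - k - 1)) * g"
      by (subst i) (simp only: power_Suc2 mult.assoc)
    then show "u i * g ^ (i - k) \<in> Q"
      using Q g(1) by (auto simp: ideal_S_iff)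
  qed
  ultimately show ?thesis
    using ideal_diff[OF Q sumQ, of "\<Sum>i\<in>{k<..n}. u i * g ^ (i - k)"] by simp
qed

text \<open>In a chain \<open>P \<subset> Q \<subset> R\<close> of primes, \<open>g \<in> Q - P\<close> and \<open>h \<in> R - Q\<close> are algebraically
  independent modulo \<open>P\<close>.\<close>

lemma prime_chain_independent:
  fixes P Q R :: "'k::field poly3 set" and c :: "nat \<times> nat \<Rightarrow> 'k"
  assumes P: "primeideal P S" and Q: "primeideal Q S" and R: "primeideal R S"
    and sub: "P \<subseteq> Q" "Q \<subseteq> R" and g: "g \<in> Q" "g \<notin> P" and h: "h \<in> R" "h \<notin> Q"
    and sum: "(\<Sum>(i, j)\<in>{..n} \<times> {..n}. Poly_Mapping.single 0 (c (i, j)) * (g ^ i * h ^ j)) \<in> P"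
  shows "\<forall>ij\<in>{..n} \<times> {..n}. c ij = 0"
proof (rule ccontr)
  assume "\<not> ?thesis"
  then obtain i0 j0 where ij0: "i0 \<le> n" "j0 \<le> n" "c (i0, j0) \<noteq> 0" by auto
  \<comment> \<open>\<open>(k, l)\<close> will be the lexicographically first index of a non-zero
    coefficient. Comparing lowest powers of \<open>g\<close> puts \<open>u k\<close> into
    \<open>Q\<close>; comparing lowest powers of \<open>h\<close> then puts the unit
    \<open>c (k, l)\<close> into \<open>R\<close>.\<close>
  define k where "k = (LEAST i. \<exists>j\<le>n. c (i, j) \<noteq> 0)"
  have "\<exists>j\<le>n. c (i0, j) \<noteq> 0" using ij0 by blast
  then have k: "\<exists>j\<le>n. c (k, j) \<noteq> 0" "k \<le> i0"
    unfolding k_def by (rule LeastI, rule Least_le)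
  have k_min: "c (i, j) = 0" if "i < k" "j \<le> n" for i j
    using not_less_Least[OF that(1)[unfolded k_def]] that(2) by blast
  obtain j1 where j1: "j1 \<le> n" "c (k, j1) \<noteq> 0" using k(1) by blast
  define l where "l = (LEAST j. c (k, j) \<noteq> 0)"
  have l: "c (k, l) \<noteq> 0" "l \<le> j1"
    using j1(2) unfolding l_def by (rule LeastI, rule Least_le)
  have l_min: "c (k, j) = 0" if "j < l" for j
    using not_less_Least[OF that[unfolded l_def]] by blast
  have "k \<le> n" "l \<le> n" using k(2) ij0(1) l(2) j1(1) by simp_all
  define u where "u i = (\<Sum>j\<le>n. Poly_Mapping.single 0 (c (i, j)) * h ^ j)" for i
  have idQ: "ideal Q S" and idR: "ideal R S" using Q R by (simp_all add: primeideal_S_iff)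
  have "(\<Sum>i\<le>n. u i * g ^ i) \<in> P"
    using sum unfolding u_def sum_distrib_right sum.cartesian_product by (simp only: mult_ac)
  then have "u k \<in> Q"
    using \<open>k \<le> n\<close> k_min
    by (intro prime_polynomial_relation[OF P idQ sub(1) g, where n = n]) (auto simp: u_def)
  then have "Poly_Mapping.single 0 (c (k, l)) \<in> R"
    unfolding u_def using \<open>l \<le> n\<close> l_min
    by (intro prime_polynomial_relation[OF Q idR sub(2) h, where n = n and u = "\<lambda>j. Poly_Mapping.single 0 (c (k, j))"]) auto
  then have "Poly_Mapping.single 0 (inverse (c (k, l))) * Poly_Mapping.single 0 (c (k, l)) \<in> R"
    using idR unfolding ideal_S_iff by blast
  then have "1 \<in> R"
    using l(1) by (simp add: Poly_Mapping.mult_single)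
  then show False using R by (simp add: primeideal_S_iff)
qed

section \<open>Krull dimension one in terms of chains of primes\<close>

lemma ideal_dim_eq_1I:
  fixes I :: "'k::field poly3 set"
  assumes I: "ideal I S"
    and no: "\<And>P Q R. \<lbrakk>primeideal P S; primeideal Q S; primeideal R S; I \<subseteq> P; P \<subset> Q; Q \<subset> R\<rbrakk> \<Longrightarrow> False"
    and "primeideal P S" "primeideal Q S" "I \<subseteq> P" "P \<subset> Q"
  shows "ideal_dim I = 1"
  unfolding ideal_dim_eq_Sup[OF I]
proof (rule Sup_eqI)
  fix y
  assume "y \<in> {ereal (real n) | n. \<exists>Q. (\<forall>i\<le>n. primeideal (Q i) S \<and> I \<subseteq> Q i) \<and> (\<forall>i<n. Q i \<subset> Q (Suc i))}"
  then obtain n Q where y: "y = ereal (real n)" and Q: "\<forall>i\<le>n. primeideal (Q i) S \<and> I \<subseteq> Q i"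
    "\<forall>i<n. Q i \<subset> Q (Suc i)" by blast
  have "n \<le> 1"
  proof (rule ccontr)
    assume "\<not> n \<le> 1"
    then show False
      using no[of "Q 0" "Q (Suc 0)" "Q (Suc (Suc 0))"] Q by simp
  qed
  then show "y \<le> 1" by (simp add: y one_ereal_def)
next
  fix y :: ereal
  assume y: "\<And>z. z \<in> {ereal (real n) | n. \<exists>Q. (\<forall>i\<le>n. primeideal (Q i) S \<and> I \<subseteq> Q i) \<and> (\<forall>i<n. Q i \<subset> Q (Suc i))}
    \<Longrightarrow> z \<le> y"
  show "1 \<le> y"
  proof (rule y, intro CollectI exI conjI)
    show "1 = ereal (real 1)" by (simp add: one_ereal_def)
    let ?C = "\<lambda>i :: nat. if i = 0 then P else Q"
    show "\<forall>i\<le>1. primeideal (?C i) S \<and> I \<subseteq> ?C i" "\<forall>i<1. ?C i \<subset> ?C (Suc i)"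
      using assms by auto
  qed
qed

lemma ideal_dim_neq_1I:
  fixes I :: "'k::field poly3 set"
  assumes I: "ideal I S" and "primeideal P S" "primeideal Q S" "primeideal R S" "I \<subseteq> P" "P \<subset> Q" "Q \<subset> R"
  shows "ideal_dim I \<noteq> 1"
proof -
  let ?C = "\<lambda>i :: nat. if i = 0 then P else if i = 1 then Q else R"
  have "\<forall>i\<le>2. primeideal (?C i) S \<and> I \<subseteq> ?C i" "\<forall>i<2. ?C i \<subset> ?C (Suc i)"
    using assms by (auto simp: less_2_cases_iff)
  then have "ereal (real 2) \<le> ideal_dim I"
    unfolding ideal_dim_eq_Sup[OF I] by (intro Sup_upper CollectI exI[of _ 2] conjI exI[of _ ?C] refl)
  then show ?thesis by (auto simp: one_ereal_def)
qed

section \<open>The positive weight orthogonal to the columns of a CB matrix\<close>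

lemma cross_product_orthogonal:
  fixes y w z x :: int
  shows "(y * w + z * c2) * (c1 * a - x * b + (x - c1) * e) +
    (z * x + c1 * w) * (- y * a + c2 * b + (y - c2) * e) +
    (c1 * c2 - x * y) * (- z * a - w * b + (z + w) * e) = 0"
  by (simp add: algebra_simps)

text \<open>The weight consists of the 2x2 minors of the first two columns. The vectors
  \<open>n2\<close> and \<open>n3\<close> will allow powers of the second and third variable with
  exponent \<open>d $ 1\<close> to be traded for powers of the first.\<close>

lemma CB_matrix_weights:
  assumes "CB_matrix L"
  obtains d :: "nat ^ 3" and n2 n3 :: "int ^ 3" where "\<And>i. d $ i > 0"
    and "\<And>n. (\<Sum>i\<in>UNIV. int (d $ i) * (L *v n) $ i) = 0"
    and "(L *v n2) $ 1 = int (d $ 2)" "(L *v n2) $ 2 = - int (d $ 1)" "(L *v n2) $ 3 = 0"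
    and "(L *v n3) $ 1 = int (d $ 3)" "(L *v n3) $ 2 = 0" "(L *v n3) $ 3 = - int (d $ 1)"
proof -
  define x y z w c1 c2 where "x = - (L $ 1 $ 2)" and "y = - (L $ 2 $ 1)" and "z = - (L $ 3 $ 1)"
    and "w = - (L $ 3 $ 2)" and "c1 = L $ 1 $ 1" and "c2 = L $ 2 $ 2"
  note defs = x_def y_def z_def w_def c1_def c2_def
  have row: "L $ i $ 1 + L $ i $ 2 + L $ i $ 3 = 0" for i
  proof -
    have "(L *v 1) $ i = 0" using assms by (simp add: CB_matrix_def)
    then show ?thesis by (simp add: matrix_vector_mult_def sum_3)
  qed
  have L3: "L $ 1 $ 3 = x - c1" "L $ 2 $ 3 = y - c2" "L $ 3 $ 3 = z + w"
    using row[of 1] row[of 2] row[of 3] by (simp_all add: defs)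
  have L12: "L $ 1 $ 1 = c1" "L $ 1 $ 2 = - x" "L $ 2 $ 1 = - y" "L $ 2 $ 2 = c2" "L $ 3 $ 1 = - z" "L $ 3 $ 2 = - w"
    by (simp_all add: defs)
  have diag: "0 < L $ i $ i" and off: "i \<noteq> j \<Longrightarrow> L $ i $ j \<le> 0" and col: "\<exists>i. i \<noteq> j \<and> L $ i $ j \<noteq> 0" for i j
    using assms by (simp_all add: CB_matrix_def)
  have nonneg: "0 \<le> x" "0 \<le> y" "0 \<le> z" "0 \<le> w" "x \<le> c1" "y \<le> c2" "0 < c1" "0 < c2" "0 < z + w"
    using off[of 1 2] off[of 2 1] off[of 3 1] off[of 3 2] off[of 1 3] off[of 2 3] diag[of 1] diag[of 2] diag[of 3]
    unfolding L12 L3 by simp_all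
  \<comment> \<open>One disjunction for each column, from its non-zero off-diagonal entry; together
    with the signs they keep all three minors positive.\<close>
  have pos: "0 < y \<or> 0 < z" "0 < x \<or> 0 < w" "x < c1 \<or> y < c2"
    using col[of 1] col[of 2] col[of 3] nonneg unfolding ex_3 by (auto simp: L12 L3)
  define d1 d2 d3 where "d1 = y * w + z * c2" and "d2 = z * x + c1 * w" and "d3 = c1 * c2 - x * y"
  have d1: "0 < d1"
  proof (cases "z = 0")
    case True
    then show ?thesis using nonneg pos by (simp add: d1_def)
  next
    case False
    then have "0 < z * c2" "0 \<le> y * w" using nonneg by simp_all
    then show ?thesis by (simp add: d1_def)
  qed
  have d2: "0 < d2"
  proof (cases "w = 0")
    case True
    then show ?thesis using nonneg pos by (simp add: d2_def)
  next
    case False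
    then have "0 < c1 * w" "0 \<le> z * x" using nonneg by simp_all
    then show ?thesis by (simp add: d2_def)
  qed
  have d3: "0 < d3"
  proof (cases "x < c1")
    case True
    have "x * y \<le> x * c2" using nonneg by (intro mult_left_mono)
    also have "\<dots> < c1 * c2" using True nonneg by (intro mult_strict_right_mono)
    finally show ?thesis by (simp add: d3_def)
  next
    case False
    have "x * y \<le> c1 * y" using nonneg by (intro mult_right_mono)
    also have "\<dots> < c1 * c2" using False pos nonneg by (intro mult_strict_left_mono) auto
    finally show ?thesis by (simp add: d3_def)
  qed
  define d :: "nat ^ 3" where "d = vector [nat d1, nat d2, nat d3]"
  have d: "int (d $ 1) = d1" "int (d $ 2) = d2" "int (d $ 3) = d3"
    using d1 d2 d3 by (simp_all add: d_def)
  have Lv: "(L *v n) $ 1 = c1 * n $ 1 - x * n $ 2 + (x - c1) * n $ 3"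
    "(L *v n) $ 2 = - y * n $ 1 + c2 * n $ 2 + (y - c2) * n $ 3"
    "(L *v n) $ 3 = - z * n $ 1 - w * n $ 2 + (z + w) * n $ 3" for n
    by (simp_all add: matrix_vector_mult_def sum_3 L12 L3)
  show thesis
  \<comment> \<open>The combinations of the first two columns that cancel the third and the second
    coordinate respectively; the surviving coordinates are minors.\<close>
  proof (rule that[of d "vector [w, - z, 0]" "vector [c2, y, 0]"])
    have "\<forall>i. 0 < d $ i" using d1 d2 d3 d unfolding forall_3 by linarith
    then show "0 < d $ i" for i by blast
    show "(\<Sum>i\<in>UNIV. int (d $ i) * (L *v n) $ i) = 0" for n
      unfolding sum_3 Lv d d1_def d2_def d3_def by (rule cross_product_orthogonal)
    show "(L *v vector [w, - z, 0]) $ 1 = int (d $ 2)" "(L *v vector [w, - z, 0]) $ 2 = - int (d $ 1)"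
      "(L *v vector [w, - z, 0]) $ 3 = 0" "(L *v vector [c2, y, 0]) $ 1 = int (d $ 3)"
      "(L *v vector [c2, y, 0]) $ 2 = 0" "(L *v vector [c2, y, 0]) $ 3 = - int (d $ 1)"
      unfolding Lv d vector_3 d1_def d2_def d3_def by (simp_all add: mult.commute)
  qed
qed

section \<open>Linear growth modulo the ideal in weighted degree\<close>

lemma lookup_single_0_mult: "Poly_Mapping.lookup (Poly_Mapping.single 0 c * f) m = c * Poly_Mapping.lookup f m"
  for f :: "'k::field poly3"
  by (simp add: mult_map_scale_conv_mult[symmetric] Poly_Mapping.map.rep_eq when_def)

definition degree_le :: "nat ^ 3 \<Rightarrow> nat \<Rightarrow> 'k::field poly3 \<Rightarrow> bool"
  where "degree_le d e f \<longleftrightarrow> (\<forall>m\<in>Poly_Mapping.keys f. weighted_degree d m \<le> e)"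

lemma degree_le_mult: "degree_le d e f \<Longrightarrow> degree_le d e' g \<Longrightarrow> degree_le d (e + e') (f * g)"
  unfolding degree_le_def using keys_mult[of f g] by (fastforce simp: weighted_degree_add intro: add_mono)

lemma degree_le_power: "degree_le d e f \<Longrightarrow> degree_le d (i * e) (f ^ i)"
  by (induction i) (auto intro: degree_le_mult, simp add: degree_le_def)

lemma degree_le_mono: "degree_le d e f \<Longrightarrow> e \<le> e' \<Longrightarrow> degree_le d e' f"
  by (auto simp: degree_le_def)

lemma degree_le_exists: "\<exists>e. degree_le d e f"
  unfolding degree_le_def
  by (intro exI[of _ "\<Sum>m\<in>Poly_Mapping.keys f. weighted_degree d m"] ballI member_le_sum) auto

text \<open>With two exponents bounded by a constant only the first can grow, so the count is linear
  in \<open>e\<close>.\<close>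

lemma finite_card_low_monomials:
  fixes d :: "nat ^ 3"
  assumes "0 < d $ 1"
  shows "finite {m :: nat ^ 3. weighted_degree d m \<le> e \<and> m $ 2 < N \<and> m $ 3 < N}"
    and "card {m :: nat ^ 3. weighted_degree d m \<le> e \<and> m $ 2 < N \<and> m $ 3 < N} \<le> (e + 1) * N\<^sup>2"
proof -
  let ?B = "{m :: nat ^ 3. weighted_degree d m \<le> e \<and> m $ 2 < N \<and> m $ 3 < N}"
  let ?f = "\<lambda>(i, j, k). vector [i, j, k] :: nat ^ 3"
  let ?C = "{..e} \<times> {..<N} \<times> {..<N}"
  have sub: "?B \<subseteq> ?f ` ?C"
  proof
    fix m assume m: "m \<in> ?B"
    have "m $ 1 \<le> d $ 1 * m $ 1" using assms by simp
    also have "\<dots> \<le> weighted_degree d m" by (simp add: weighted_degree_def sum_3)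
    finally have "m $ 1 \<le> e" using m by simp
    moreover have "m = ?f (m $ 1, m $ 2, m $ 3)" by (simp add: vec_eq_iff forall_3)
    ultimately show "m \<in> ?f ` ?C" using m by (intro image_eqI[of _ _ "(m $ 1, m $ 2, m $ 3)"]) auto
  qed
  then show "finite ?B" by (rule finite_subset) simp
  have "card ?B \<le> card ?C"
    using sub by (rule surj_card_le[rotated]) simp
  then show "card ?B \<le> (e + 1) * N\<^sup>2"
    by (simp add: power2_eq_square)
qed

text \<open>The linear extension of \<rho> gives a representative modulo \<open>I\<close> supported
  on reduced monomials.\<close>

lemma exists_reduction:
  fixes I :: "'k::field poly3 set"
  assumes I: "ideal I S" and "\<And>m. monomial m - monomial (\<rho> m) \<in> I"
  obtains f' where "f - f' \<in> I" "Poly_Mapping.keys f' \<subseteq> \<rho> ` Poly_Mapping.keys f"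
proof -
  let ?s = "\<lambda>m. Poly_Mapping.single 0 (Poly_Mapping.lookup f m)"
  define f' where "f' = (\<Sum>m\<in>Poly_Mapping.keys f. ?s m * monomial (\<rho> m))"
  have "f = (\<Sum>m\<in>Poly_Mapping.keys f. ?s m * monomial m)"
    by (subst poly_mapping_sum_single[of f]) (simp add: monomial_def Poly_Mapping.mult_single)
  then have "f - f' = (\<Sum>m\<in>Poly_Mapping.keys f. ?s m * (monomial m - monomial (\<rho> m)))"
    by (simp add: f'_def right_diff_distrib sum_subtractf)
  also have "\<dots> \<in> I"
    using assms by (intro ideal_sum) (auto simp: ideal_S_iff)
  finally have "f - f' \<in> I" .
  moreover have "Poly_Mapping.keys f' \<subseteq> \<rho> ` Poly_Mapping.keys f"
  proof
    fix b assume "b \<in> Poly_Mapping.keys f'"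
    then have "(\<Sum>m\<in>Poly_Mapping.keys f. Poly_Mapping.lookup f m * (1 when \<rho> m = b)) \<noteq> 0"
      by (simp add: in_keys_iff f'_def lookup_sum lookup_single_0_mult monomial_def lookup_single)
    then obtain m where "m \<in> Poly_Mapping.keys f" "Poly_Mapping.lookup f m * (1 when \<rho> m = b) \<noteq> 0"
      by (rule sum.not_neutral_contains_not_neutral)
    then show "b \<in> \<rho> ` Poly_Mapping.keys f" by (auto simp: when_def split: if_splits)
  qed
  ultimately show thesis by (rule that)
qed

text \<open>Modulo \<open>I\<close>, the polynomials of degree at most \<open>e\<close> are spanned by \<open>O(e)\<close> monomials, but
  algebraic independence of \<open>g\<close> and \<open>h\<close> would require quadratic growth.\<close>

lemma no_prime_chain:
  fixes I :: "'k::field poly3 set" and d :: "nat ^ 3" and \<rho> :: "nat ^ 3 \<Rightarrow> nat ^ 3"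
  assumes I: "ideal I S" and red: "\<And>m. monomial m - monomial (\<rho> m) \<in> I"
    and deg: "\<And>m. weighted_degree d (\<rho> m) = weighted_degree d m"
    and \<rho>: "\<And>m. \<rho> m $ 2 < N" "\<And>m. \<rho> m $ 3 < N" and d: "0 < d $ 1"
    and P: "primeideal P S" and Q: "primeideal Q S" and R: "primeideal R S"
    and sub: "I \<subseteq> P" "P \<subset> Q" "Q \<subset> R"
  shows False
proof -
  obtain g where g: "g \<in> Q" "g \<notin> P" using sub by blast
  obtain h where h: "h \<in> R" "h \<notin> Q" using sub by blast
  obtain eg eh where "degree_le d eg g" "degree_le d eh h"
    using degree_le_exists by metis
  define e where "e = max eg eh"
  have e: "degree_le d e g" "degree_le d e h"
    using \<open>degree_le d eg g\<close> \<open>degree_le d eh h\<close> by (auto simp: e_def intro: degree_le_mono)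
  \<comment> \<open>Chosen so that the bound on \<open>card B\<close> is at most
    \<open>(n + 1) * n\<close>, below the number \<open>(n + 1)\<^sup>2\<close> of products
    \<open>g ^ i * h ^ j\<close>; their degrees are at most \<open>2 * n * e\<close>.\<close>
  define n where "n = (2 * e + 1) * N\<^sup>2"
  define B where "B = {m :: nat ^ 3. weighted_degree d m \<le> 2 * n * e \<and> m $ 2 < N \<and> m $ 3 < N}"
  define A where "A = {..n} \<times> {..n}"
  have "\<exists>f'. g ^ i * h ^ j - f' \<in> I \<and> Poly_Mapping.keys f' \<subseteq> \<rho> ` Poly_Mapping.keys (g ^ i * h ^ j)" for i j
    by (rule exists_reduction[OF I red, of "g ^ i * h ^ j"]) blast
  then have "\<forall>i j. \<exists>f'. g ^ i * h ^ j - f' \<in> I \<and> Poly_Mapping.keys f' \<subseteq> \<rho> ` Poly_Mapping.keys (g ^ i * h ^ j)"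
    by blast
  then obtain r where r: "g ^ i * h ^ j - r i j \<in> I"
    "Poly_Mapping.keys (r i j) \<subseteq> \<rho> ` Poly_Mapping.keys (g ^ i * h ^ j)" for i j
    unfolding choice_iff by blast
  have rB: "Poly_Mapping.keys (r i j) \<subseteq> B" if "(i, j) \<in> A" for i j
  proof -
    have "i * e + j * e \<le> 2 * n * e"
      using that by (simp add: A_def flip: distrib_right)
    then have "degree_le d (2 * n * e) (g ^ i * h ^ j)"
      using e by (blast intro: degree_le_mono degree_le_mult degree_le_power)
    then have "\<rho> ` Poly_Mapping.keys (g ^ i * h ^ j) \<subseteq> B"
      using \<rho> by (auto simp: degree_le_def B_def deg)
    with r(2) show ?thesis by (rule order_trans)
  qed
  have "finite B" and "card B \<le> (2 * n * e + 1) * N\<^sup>2"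
    unfolding B_def by (rule finite_card_low_monomials[OF d])+
  note this(2)
  also have "(2 * n * e + 1) * N\<^sup>2 \<le> (n + 1) * (2 * e + 1) * N\<^sup>2"
    by (rule mult_right_mono) simp_all
  also have "\<dots> = (n + 1) * n"
    unfolding n_def by (rule mult.assoc)
  also have "\<dots> < card A"
    by (simp add: A_def)
  finally have "card B < card A" by simp
  moreover have "finite A" by (simp add: A_def)
  ultimately obtain c where c: "\<exists>ij\<in>A. c ij \<noteq> 0"
    "\<forall>b\<in>B. (\<Sum>ij\<in>A. c ij * Poly_Mapping.lookup (case ij of (i, j) \<Rightarrow> r i j) b) = 0"
    using exists_nontrivial_relation[OF \<open>finite B\<close>, of A "\<lambda>ij. Poly_Mapping.lookup (case ij of (i, j) \<Rightarrow> r i j)"]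
    by blast
  let ?s = "\<lambda>ij. Poly_Mapping.single 0 (c ij)"
  \<comment> \<open>The relation found on \<open>B\<close> holds at all monomials, since the reduced
    products are supported in \<open>B\<close>. It therefore lifts to a relation between the
    products themselves modulo \<open>I\<close>.\<close>
  have zero: "(\<Sum>(i, j)\<in>A. ?s (i, j) * r i j) = 0"
  proof (rule poly_mapping_eqI)
    fix b
    have "(\<Sum>ij\<in>A. c ij * Poly_Mapping.lookup (case ij of (i, j) \<Rightarrow> r i j) b) = 0"
    proof (cases "b \<in> B")
      case False
      then have "Poly_Mapping.lookup (r i j) b = 0" if "(i, j) \<in> A" for i j
        using rB[OF that] by (metis in_keys_iff subsetD)
      then show ?thesis by (intro sum.neutral) auto
    qed (use c(2) in blast)
    then show "Poly_Mapping.lookup (\<Sum>(i, j)\<in>A. ?s (i, j) * r i j) b = Poly_Mapping.lookup 0 b"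
      by (simp add: lookup_sum lookup_single_0_mult case_prod_unfold)
  qed
  have "(\<Sum>(i, j)\<in>A. ?s (i, j) * (g ^ i * h ^ j - r i j)) \<in> I"
    using r(1) I by (intro ideal_sum) (auto simp: ideal_S_iff)
  also have "(\<Sum>(i, j)\<in>A. ?s (i, j) * (g ^ i * h ^ j - r i j)) =
      (\<Sum>(i, j)\<in>A. ?s (i, j) * (g ^ i * h ^ j)) - (\<Sum>(i, j)\<in>A. ?s (i, j) * r i j)"
    by (simp add: right_diff_distrib case_prod_unfold sum_subtractf)
  finally have "(\<Sum>(i, j)\<in>A. ?s (i, j) * (g ^ i * h ^ j)) \<in> P"
    using sub(1) by (auto simp: zero)
  then have "\<forall>ij\<in>A. c ij = 0"
    unfolding A_def using sub by (intro prime_chain_independent[OF P Q R _ _ g h]) auto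
  then show False using c(1) by blast
qed

lemma CB_matrix_imp_lattice_ideal_dim_1:
  fixes I :: "'k::field poly3 set"
  assumes L: "CB_matrix L" and I: "I = ideal_gen {binomial (column i L) | i. True}"
  shows "homogeneous_ideal I" "lattice_ideal I" "ideal_dim I = 1"
proof -
  have I': "I = ideal_gen (binomial ` range ((*v) L))"
    using CB_ideal_eq_lattice_ideal[OF L] I by simp
  have idI: "ideal I S" unfolding I by (rule ideal_gen_ideal)
  obtain d :: "nat ^ 3" and n2 n3 :: "int ^ 3" where d: "\<And>i. d $ i > 0"
    and orth: "\<And>n. (\<Sum>i\<in>UNIV. int (d $ i) * (L *v n) $ i) = 0"
    and n2: "(L *v n2) $ 1 = int (d $ 2)" "(L *v n2) $ 2 = - int (d $ 1)" "(L *v n2) $ 3 = 0"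
    and n3: "(L *v n3) $ 1 = int (d $ 3)" "(L *v n3) $ 2 = 0" "(L *v n3) $ 3 = - int (d $ 1)"
    by (rule CB_matrix_weights[OF L], rule that)
  show "homogeneous_ideal I"
    unfolding I' using d orth by (intro homogeneous_ideal_if_orthogonal) auto
  have "additive_subgroup (range ((*v) L)) (ring_of_type_algebra :: (int ^ 3) ring)"
    unfolding additive_subgroup_type_algebra_iff
  proof (intro conjI ballI)
    show "0 \<in> range ((*v) L)" by (rule range_eqI[of _ _ 0]) simp
    show "x + y \<in> range ((*v) L)" if "x \<in> range ((*v) L)" "y \<in> range ((*v) L)" for x y
      using that by (auto simp flip: matrix_vector_right_distrib)
    show "- x \<in> range ((*v) L)" if x: "x \<in> range ((*v) L)" for x
    proof -
      obtain n where "x = L *v n" using x by blast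
      then show ?thesis
        using matrix_vector_mult_diff_distrib[of L 0 n] by (intro range_eqI[of _ _ "- n"]) simp
    qed
  qed
  then show "lattice_ideal I"
    unfolding lattice_ideal_def using I' by blast
  \<comment> \<open>Exponents two and three are reduced modulo \<open>d $ 1\<close>; each quotient
    is paid for by \<open>d $ 2\<close> or \<open>d $ 3\<close> in the first exponent, as
    \<open>n2\<close> and \<open>n3\<close> permit.\<close>
  define \<rho> :: "nat ^ 3 \<Rightarrow> nat ^ 3" where "\<rho> m = vector [m $ 1 + d $ 2 * (m $ 2 div d $ 1) + d $ 3 * (m $ 3 div d $ 1),
    m $ 2 mod d $ 1, m $ 3 mod d $ 1]" for m
  have \<rho>: "\<exists>n. \<forall>i. int (m $ i) - int (\<rho> m $ i) = (L *v n) $ i" for m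
  proof
    let ?n = "- int (m $ 2 div d $ 1) *s n2 - int (m $ 3 div d $ 1) *s n3"
    have "L *v ?n = - int (m $ 2 div d $ 1) *s (L *v n2) - int (m $ 3 div d $ 1) *s (L *v n3)"
      by (simp add: vec_eq_iff matrix_vector_mult_def sum_3 algebra_simps)
    moreover have "int (m $ k) - int (m $ k mod d $ 1) = int (m $ k div d $ 1) * int (d $ 1)" for k
      by (metis add_diff_cancel_right' div_mult_mod_eq of_nat_add of_nat_mult)
    ultimately show "\<forall>i. int (m $ i) - int (\<rho> m $ i) = (L *v ?n) $ i"
      unfolding forall_3 by (simp add: \<rho>_def n2 n3)
  qed
  show "ideal_dim I = 1"
  \<comment> \<open>The lower bound comes from the kernel of the substitution with exponents
    \<open>d\<close> and the kernel of its composition with x = 0.\<close>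
  proof (rule ideal_dim_eq_1I[OF idI _ primeideal_ker(1,2) _ ker_xy_psubset_ker_y[OF d]])
    have "binomial ` range ((*v) L) \<subseteq> (ker_xy d 0 :: 'k poly3 set)"
      using orth by (auto simp: ker_xy_def ev_binomial_eq_0_iff)
    then show "I \<subseteq> ker_xy d 0"
      unfolding I' using ideal_gen_subset_iff primeideal_ker(1) primeideal_S_iff by blast
    fix P Q R :: "'k poly3 set"
    assume *: "primeideal P S" "primeideal Q S" "primeideal R S" "I \<subseteq> P" "P \<subset> Q" "Q \<subset> R"
    have "binomial (column k L) \<in> I" for k
      unfolding I by (rule subsetD[OF ideal_gen_superset]) blast
    then have red: "monomial m - monomial (\<rho> m) \<in> I" for m
      using \<rho>[of m] CB_matrix_monomial_diff_mem[OF L idI] by blast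
    have deg: "weighted_degree d (\<rho> m) = weighted_degree d m" for m
    proof -
      obtain n where n: "\<forall>i. int (m $ i) - int (\<rho> m $ i) = (L *v n) $ i" using \<rho> by blast
      have "int (weighted_degree d m) - int (weighted_degree d (\<rho> m)) = (\<Sum>i\<in>UNIV. int (d $ i) * (int (m $ i) - int (\<rho> m $ i)))"
        by (simp add: weighted_degree_def right_diff_distrib sum_subtractf)
      also have "\<dots> = 0" using n orth[of n] by simp
      finally show ?thesis by simp
    qed
    show False
      by (rule no_prime_chain[OF idI red deg _ _ d *, of "d $ 1"]) (simp_all add: \<rho>_def d)
  qed
qed

subsection \<open>Lattices of rank two\<close>

lemma additive_subgroup_smult:
  fixes x :: "int ^ 'n"
  assumes H: "additive_subgroup H ring_of_type_algebra" and x: "x \<in> H"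
  shows "c *s x \<in> H"
proof -
  have closed: "0 \<in> H" "\<And>x y. x \<in> H \<Longrightarrow> y \<in> H \<Longrightarrow> x + y \<in> H" "\<And>x. x \<in> H \<Longrightarrow> - x \<in> H"
    using H unfolding additive_subgroup_type_algebra_iff by blast+
  have nat: "int n *s x \<in> H" for n
  proof (induction n)
    case (Suc n)
    have "int (Suc n) *s x = int n *s x + x" by (simp add: vec_eq_iff algebra_simps)
    then show ?case using Suc closed x by simp
  qed (simp add: closed)
  show ?thesis
  proof (cases "c < 0")
    case True
    then have "c *s x = - (int (nat (- c)) *s x)" by (simp add: vec_eq_iff)
    then show ?thesis using closed(3)[OF nat, of "nat (- c)"] by simp
  next
    case False
    then show ?thesis using nat[of "nat c"] by simp
  qed
qed

text \<open>A Euclidean descent on the basis \<open>u, w\<close>: as long as \<open>(u, -w, w - u)\<close> are not the columns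
  of a CB matrix, \<open>u\<close> or \<open>w\<close> may be replaced by the difference of both.\<close>

lemma exists_CB_matrix_of_basis:
  fixes u w :: "int ^ 3" and d :: "nat ^ 3"
  assumes d: "\<And>i. 0 < d $ i"
  shows "\<lbrakk>(\<Sum>i\<in>UNIV. int (d $ i) * u $ i) = 0; (\<Sum>i\<in>UNIV. int (d $ i) * w $ i) = 0;
      0 < u $ 1; u $ 2 \<le> 0; u $ 3 < 0; 0 < w $ 1; w $ 2 < 0; 0 \<le> w $ 3\<rbrakk>
    \<Longrightarrow> \<exists>L. CB_matrix L \<and> range ((*v) L) = {i *s u + j *s w | i j. True}"
proof (induction "nat (u $ 1 - u $ 2 + w $ 1 - w $ 2)" arbitrary: u w rule: less_induct)
  case less
  note prems = less.prems
  have d1: "0 < int (d $ 1)" and d2: "0 < int (d $ 2)" and d3: "0 < int (d $ 3)" using d by simp_all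
  have orth: "int (d $ 1) * (w $ 1 - u $ 1) + int (d $ 2) * (w $ 2 - u $ 2) + int (d $ 3) * (w $ 3 - u $ 3) = 0"
    using prems(1,2) by (simp add: sum_3 right_diff_distrib)
  have orth': "(\<Sum>i\<in>UNIV. int (d $ i) * (w - u) $ i) = 0" "(\<Sum>i\<in>UNIV. int (d $ i) * (u - w) $ i) = 0"
    using prems(1,2) by (simp_all add: right_diff_distrib sum_subtractf)
  have p3: "0 < int (d $ 3) * (w $ 3 - u $ 3)"
    using d3 prems by simp
  \<comment> \<open>In the case \<open>CB\<close> the vector \<open>w - u\<close> has the signs of a
    third column. Otherwise orthogonality to \<open>d\<close> with \<open>w $ 3 > u $ 3\<close>
    makes the comparison of the other two coordinates strict, so the new vector keeps its sign
    pattern. The measure drops by \<open>w $ 1 - w $ 2\<close> or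
    \<open>u $ 1 - u $ 2\<close>.\<close>
  consider (CB) "w $ 1 \<le> u $ 1" "w $ 2 \<le> u $ 2" | (u) "w $ 1 \<le> u $ 1" "u $ 2 < w $ 2"
    | (w) "u $ 1 < w $ 1" by linarith
  then show ?case
  proof cases
    case CB
    define L :: "int ^ 3 ^ 3" where "L = (\<chi> i j. if j = 1 then u $ i else if j = 2 then - w $ i else w $ i - u $ i)"
    have Lv: "L *v n = (n $ 1 - n $ 3) *s u + (n $ 3 - n $ 2) *s w" for n
      by (simp add: vec_eq_iff L_def matrix_vector_mult_def sum_3 algebra_simps)
    \<comment> \<open>Otherwise \<open>w - u\<close> would have only its positive third entry,
      contradicting orthogonality to \<open>d\<close>.\<close>
    have "w $ 1 - u $ 1 \<noteq> 0 \<or> w $ 2 - u $ 2 \<noteq> 0"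
      using orth p3 by auto
    then have "CB_matrix L"
      using prems CB unfolding CB_matrix_def forall_3 ex_3
      by (simp add: L_def vec_eq_iff matrix_vector_mult_def sum_3)
    moreover have "range ((*v) L) = {i *s u + j *s w | i j. True}"
    proof
      show "range ((*v) L) \<subseteq> {i *s u + j *s w | i j. True}" unfolding Lv by blast
      show "{i *s u + j *s w | i j. True} \<subseteq> range ((*v) L)"
      proof
        fix x assume "x \<in> {i *s u + j *s w | i j. True}"
        then obtain i j where "x = i *s u + j *s w" by blast
        then have "x = L *v vector [i, - j, 0]" by (simp add: Lv)
        then show "x \<in> range ((*v) L)" by blast
      qed
    qed
    ultimately show ?thesis by blast
  next
    case u
    have "0 < int (d $ 2) * (w $ 2 - u $ 2)" using d2 u by simp
    then have "int (d $ 1) * (w $ 1 - u $ 1) < 0" using orth p3 by linarith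
    then have lt: "w $ 1 < u $ 1" using d1 by (simp add: mult_less_0_iff)
    have "\<exists>L. CB_matrix L \<and> range ((*v) L) = {i *s (u - w) + j *s w | i j. True}"
      by (rule less.hyps) (use prems orth' u lt in simp_all)
    moreover have "{i *s (u - w) + j *s w | i j. True} = {i *s u + j *s w | i j. True}" (is "?A = ?B")
    proof (intro Set.equalityI subsetI)
      fix x assume "x \<in> ?A"
      then obtain i j where "x = i *s (u - w) + j *s w" by blast
      then have "x = i *s u + (j - i) *s w" by (simp add: vec_eq_iff algebra_simps)
      then show "x \<in> ?B" by blast
    next
      fix x assume "x \<in> ?B"
      then obtain i j where "x = i *s u + j *s w" by blast
      then have "x = i *s (u - w) + (i + j) *s w" by (simp add: vec_eq_iff algebra_simps)
      then show "x \<in> ?A" by blast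
    qed
    ultimately show ?thesis by simp
  next
    case w
    have "0 < int (d $ 1) * (w $ 1 - u $ 1)" using d1 w by simp
    then have "int (d $ 2) * (w $ 2 - u $ 2) < 0" using orth p3 by linarith
    then have lt: "w $ 2 < u $ 2" using d2 by (simp add: mult_less_0_iff)
    have "\<exists>L. CB_matrix L \<and> range ((*v) L) = {i *s u + j *s (w - u) | i j. True}"
      by (rule less.hyps) (use prems orth' w lt in simp_all)
    moreover have "{i *s u + j *s (w - u) | i j. True} = {i *s u + j *s w | i j. True}" (is "?A = ?B")
    proof (intro Set.equalityI subsetI)
      fix x assume "x \<in> ?A"
      then obtain i j where "x = i *s u + j *s (w - u)" by blast
      then have "x = (i - j) *s u + j *s w" by (simp add: vec_eq_iff algebra_simps)
      then show "x \<in> ?B" by blast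
    next
      fix x assume "x \<in> ?B"
      then obtain i j where "x = i *s u + j *s w" by blast
      then have "x = (i + j) *s u + j *s (w - u)" by (simp add: vec_eq_iff algebra_simps)
      then show "x \<in> ?A" by blast
    qed
    ultimately show ?thesis by simp
  qed
qed

text \<open>The last two assumptions express rank two. A basis consists of a generator
  \<open>w\<close> of the part with third coordinate zero and a vector \<open>e\<close> whose third
  coordinate generates the image of the projection; adding a multiple of \<open>w\<close> to
  \<open>e\<close> arranges the signs for the descent.\<close>

lemma exists_CB_matrix_of_lattice:
  fixes \<L> :: "(int ^ 3) set" and d :: "nat ^ 3" and w0 e0 :: "int ^ 3"
  assumes sub: "additive_subgroup \<L> ring_of_type_algebra" and d: "\<And>i. 0 < d $ i"
    and orth: "\<And>a. a \<in> \<L> \<Longrightarrow> (\<Sum>i\<in>UNIV. int (d $ i) * a $ i) = 0"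
    and w0: "w0 \<in> \<L>" "w0 $ 3 = 0" "w0 \<noteq> 0" and e0: "e0 \<in> \<L>" "e0 $ 3 \<noteq> 0"
  shows "\<exists>L. CB_matrix L \<and> range ((*v) L) = \<L>"
proof -
  have closed: "x + y \<in> \<L>" "- x \<in> \<L>" "c *s x \<in> \<L>" if "x \<in> \<L>" "y \<in> \<L>" for x y c
    using sub that additive_subgroup_smult[OF sub] unfolding additive_subgroup_type_algebra_iff by blast+
  have diff: "x - y \<in> \<L>" if "x \<in> \<L>" "y \<in> \<L>" for x y
    using closed(1)[OF that(1) closed(2)[OF that(2) that(2)]] by simp
  have d1: "0 < int (d $ 1)" and d2: "0 < int (d $ 2)" and d3: "0 < int (d $ 3)" using d by simp_all
  have flat: "int (d $ 1) * a $ 1 = - (int (d $ 2) * a $ 2)" if "a \<in> \<L>" "a $ 3 = 0" for a :: "int ^ 3"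
    using orth[OF that(1)] that(2) by (simp add: sum_3)
  have zero: "a = 0" if "a \<in> \<L>" "a $ 3 = 0" "a $ 1 = 0" for a :: "int ^ 3"
    using flat[OF that(1,2)] that(2,3) d2 by (simp add: vec_eq_iff forall_3)
  have "\<exists>w. w \<in> \<L> \<and> w $ 3 = 0 \<and> 0 < w $ 1"
  proof (cases "0 < w0 $ 1")
    case False
    then have "0 < (- w0) $ 1" using zero[OF w0(1,2)] w0(3) by fastforce
    then show ?thesis using closed(2)[OF w0(1) w0(1)] w0(2) by (intro exI[of _ "- w0"]) simp
  qed (use w0 in blast)
  then obtain w :: "int ^ 3" where w: "w \<in> \<L>" "w $ 3 = 0" "0 < w $ 1"
    and w_min: "\<And>a. a \<in> \<L> \<Longrightarrow> a $ 3 = 0 \<Longrightarrow> 0 < a $ 1 \<Longrightarrow> nat (w $ 1) \<le> nat (a $ 1)"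
    using ex_has_least_nat[of "\<lambda>w :: int ^ 3. w \<in> \<L> \<and> w $ 3 = 0 \<and> 0 < w $ 1" _ "\<lambda>w :: int ^ 3. nat (w $ 1)"] by metis
  have "\<exists>e. e \<in> \<L> \<and> e $ 3 < 0"
  proof (cases "e0 $ 3 < 0")
    case False
    then show ?thesis using closed(2)[OF e0(1) e0(1)] e0(2) by (intro exI[of _ "- e0"]) simp
  qed (use e0 in blast)
  then obtain e :: "int ^ 3" where e: "e \<in> \<L>" "e $ 3 < 0"
    and e_min: "\<And>a. a \<in> \<L> \<Longrightarrow> a $ 3 < 0 \<Longrightarrow> nat (- (e $ 3)) \<le> nat (- (a $ 3))"
    using ex_has_least_nat[of "\<lambda>e :: int ^ 3. e \<in> \<L> \<and> e $ 3 < 0" _ "\<lambda>e :: int ^ 3. nat (- (e $ 3))"] by metis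
  have w2: "w $ 2 < 0"
  proof -
    have "0 < int (d $ 1) * w $ 1" using d1 w(3) by simp
    then have "int (d $ 2) * w $ 2 < 0" using flat[OF w(1,2)] by linarith
    then show ?thesis using d2 by (simp add: mult_less_0_iff)
  qed
  \<comment> \<open>Large enough for \<open>k *s w\<close> to dominate the first two entries of
    \<open>e\<close>, because \<open>w $ 1\<close> is at least 1 and \<open>w $ 2\<close> at most
    -1.\<close>
  define k where "k = \<bar>e $ 1\<bar> + \<bar>e $ 2\<bar> + 1"
  define u where "u = e + k *s w"
  have u: "u \<in> \<L>" unfolding u_def by (rule closed(1)[OF e(1) closed(3)[OF w(1) w(1)]])
  have "k * 1 \<le> k * w $ 1" "k * 1 \<le> k * (- (w $ 2))"
    using w(3) w2 by (intro mult_left_mono; simp add: k_def)+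
  then have k: "k \<le> k * w $ 1" "k \<le> - (k * w $ 2)" "\<bar>e $ 1\<bar> < k" "\<bar>e $ 2\<bar> < k"
    by (simp_all add: k_def)
  have "u $ 1 = e $ 1 + k * w $ 1" "u $ 2 = e $ 2 + k * w $ 2" "u $ 3 = e $ 3"
    using w(2) by (simp_all add: u_def)
  then have u123: "0 < u $ 1" "u $ 2 \<le> 0" "u $ 3 < 0"
    using k e(2) by linarith+
  have "\<L> = {i *s u + j *s w | i j. True}"
  proof (intro Set.equalityI subsetI)
    fix x assume "x \<in> {i *s u + j *s w | i j. True}"
    then obtain i j where "x = i *s u + j *s w" by blast
    then show "x \<in> \<L>" using closed(1)[OF closed(3)[OF u u] closed(3)[OF w(1) w(1)]] by simp
  next
    fix v assume v: "v \<in> \<L>"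
    \<comment> \<open>Two divisions with remainder, by \<open>e $ 3\<close> and then by
      \<open>w $ 1\<close>. As \<open>e $ 3\<close> is negative, the first remainder lies above
      \<open>e $ 3\<close> and is at most 0; minimality makes both remainders vanish.\<close>
    define q where "q = v $ 3 div e $ 3"
    define v' where "v' = v - q *s e"
    have v': "v' \<in> \<L>" unfolding v'_def by (rule diff[OF v closed(3)[OF e(1) e(1)]])
    have v'3: "v' $ 3 = v $ 3 mod e $ 3"
      by (simp add: v'_def q_def minus_div_mult_eq_mod)
    have "v' $ 3 = 0"
    proof (rule ccontr)
      assume "v' $ 3 \<noteq> 0"
      moreover have "v' $ 3 \<le> 0" "e $ 3 < v' $ 3"
        unfolding v'3 using e(2) by simp_all
      ultimately show False using e_min[OF v'] by simp
    qed
    define r where "r = v' $ 1 div w $ 1"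
    define v'' where "v'' = v' - r *s w"
    have v'': "v'' \<in> \<L>" unfolding v''_def by (rule diff[OF v' closed(3)[OF w(1) w(1)]])
    have v''1: "v'' $ 1 = v' $ 1 mod w $ 1" and v''3: "v'' $ 3 = 0"
      using \<open>v' $ 3 = 0\<close> w(2) by (simp_all add: v''_def r_def minus_div_mult_eq_mod)
    have "v'' $ 1 = 0"
    proof (rule ccontr)
      assume "v'' $ 1 \<noteq> 0"
      moreover have "0 \<le> v'' $ 1" "v'' $ 1 < w $ 1"
        unfolding v''1 using w(3) by simp_all
      ultimately show False using w_min[OF v'' v''3] by simp
    qed
    then have "v'' = 0" by (intro zero v'' v''3)
    then have "v = q *s e + r *s w"
      unfolding v''_def v'_def by (simp add: diff_eq_eq add.commute)
    then have "v = q *s u + (r - q * k) *s w"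
      by (simp add: u_def vec_eq_iff algebra_simps)
    then show "v \<in> {i *s u + j *s w | i j. True}" by blast
  qed
  then show ?thesis
    using exists_CB_matrix_of_basis[OF d orth[OF u] orth[OF w(1)] u123 w(3) w2] w(2) by simp
qed

text \<open>If the lattice is not flat, it lies on the rational line through some \<open>v\<close>.
  Orthogonality to a positive \<open>d\<close> gives \<open>v\<close> entries of both signs, and
  these two entries, exchanged, yield a non-negative orthogonal \<open>p\<close>. Its zero entry
  makes the second inclusion in the chain of kernels strict.\<close>

lemma exists_orthogonal_of_low_rank:
  fixes \<L> :: "(int ^ 3) set" and d :: "nat ^ 3"
  assumes sub: "additive_subgroup \<L> ring_of_type_algebra" and d: "\<And>i. 0 < d $ i"
    and orth: "\<And>a. a \<in> \<L> \<Longrightarrow> (\<Sum>i\<in>UNIV. int (d $ i) * a $ i) = 0"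
    and low: "(\<forall>a\<in>\<L>. a $ 3 = 0) \<or> (\<forall>a\<in>\<L>. a $ 3 = 0 \<longrightarrow> a = 0)"
  obtains p :: "nat ^ 3" and i j where "0 < p $ i" "p $ j = 0"
    "\<And>a. a \<in> \<L> \<Longrightarrow> (\<Sum>i\<in>UNIV. int (p $ i) * a $ i) = 0"
proof (cases "\<forall>a\<in>\<L>. a $ 3 = 0")
  case True
  show thesis
    by (rule that[of "axis 3 1" 3 1]) (use True in \<open>simp_all add: sum_3 axis_def\<close>)
next
  case False
  then obtain v :: "int ^ 3" where v: "v \<in> \<L>" "v $ 3 \<noteq> 0" by blast
  have smult: "c *s x \<in> \<L>" if "x \<in> \<L>" for x c
    using additive_subgroup_smult[OF sub that] .
  \<comment> \<open>The combination of \<open>a\<close> and \<open>v\<close> that cancels the third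
    coordinate must be zero by \<open>low\<close>.\<close>
  have proportional: "v $ 3 * a $ i = a $ 3 * v $ i" if "a \<in> \<L>" for a i
  proof -
    have "v $ 3 *s a + (- (a $ 3)) *s v \<in> \<L>"
      using sub smult[OF that] smult[OF v(1)] unfolding additive_subgroup_type_algebra_iff by blast
    moreover have "(v $ 3 *s a + (- (a $ 3)) *s v) $ 3 = 0" by (simp add: mult.commute)
    ultimately have "v $ 3 *s a + (- (a $ 3)) *s v = 0" using low v by blast
    then have "(v $ 3 *s a + (- (a $ 3)) *s v) $ i = 0" by simp
    then show ?thesis by simp
  qed
  \<comment> \<open>Taking \<open>c\<close> to be 1 or -1 yields a positive and a negative entry. If
    there were none, all terms of the weighted sum would have the same sign and vanish, contrary to
    \<open>v $ 3 \<noteq> 0\<close>.\<close>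
  have pos: "\<exists>i. 0 < c * v $ i" if "c = 1 \<or> c = - 1" for c
  proof (rule ccontr)
    assume "\<nexists>i. 0 < c * v $ i"
    then have neg: "0 \<le> int (d $ i) * (- (c * v $ i))" for i
      by (intro mult_nonneg_nonneg of_nat_0_le_iff) (simp add: not_less)
    have "(\<Sum>i\<in>UNIV. int (d $ i) * (- (c * v $ i))) = - c * (\<Sum>i\<in>UNIV. int (d $ i) * v $ i)"
      by (simp add: sum_distrib_left algebra_simps)
    also have "\<dots> = 0" using orth[OF v(1)] by simp
    finally have "int (d $ 3) * (- (c * v $ 3)) = 0"
      using neg by (subst (asm) sum_nonneg_eq_0_iff) auto
    then show False using d[of 3] v(2) that by auto
  qed
  obtain i where i: "0 < v $ i" using pos[of 1] by auto
  obtain j where j: "v $ j < 0" using pos[of "- 1"] by auto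
  have ij: "i \<noteq> j" using i j by auto
  have "card {i, j} \<noteq> CARD(3)" using ij by simp
  then have "{i, j} \<noteq> UNIV" by metis
  then obtain k where k: "k \<noteq> i" "k \<noteq> j" by blast
  define p :: "nat ^ 3" where "p = (\<chi> l. if l = i then nat (- v $ j) else if l = j then nat (v $ i) else 0)"
  show thesis
  proof (rule that[of p i k])
    show "0 < p $ i" "p $ k = 0" using j k by (simp_all add: p_def)
    have p: "(\<Sum>l\<in>UNIV. int (p $ l) * a $ l) = - v $ j * a $ i + v $ i * a $ j" for a :: "int ^ 3"
    proof -
      have "(\<Sum>l\<in>UNIV. int (p $ l) * a $ l) = (\<Sum>l\<in>{i, j}. int (p $ l) * a $ l)"
        by (rule sum.mono_neutral_right) (auto simp: p_def)
      then show ?thesis using i j ij by (simp add: p_def)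
    qed
    fix a assume a: "a \<in> \<L>"
    have "v $ 3 * (- v $ j * a $ i + v $ i * a $ j) = - v $ j * (v $ 3 * a $ i) + v $ i * (v $ 3 * a $ j)"
      by (simp add: algebra_simps)
    also have "\<dots> = 0" unfolding proportional[OF a] by simp
    finally show "(\<Sum>l\<in>UNIV. int (p $ l) * a $ l) = 0" unfolding p using v(2) by simp
  qed
qed

lemma lattice_ideal_dim_1_imp_CB_ideal:
  fixes I :: "'k::field poly3 set"
  assumes hom: "homogeneous_ideal I" and lat: "lattice_ideal I" and dim: "ideal_dim I = 1"
  shows "CB_ideal I"
proof -
  obtain d :: "nat ^ 3" and G where d: "\<And>i. 0 < d $ i" and G: "\<And>g. g \<in> G \<Longrightarrow> homogeneous_poly d g" "I = ideal_gen G"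
    using hom unfolding homogeneous_ideal_def by blast
  obtain \<L> :: "(int ^ 3) set" where sub: "additive_subgroup \<L> ring_of_type_algebra"
    and \<L>: "I = ideal_gen (binomial ` \<L>)"
    using lat unfolding lattice_ideal_def by blast
  have orth: "(\<Sum>i\<in>UNIV. int (d $ i) * a $ i) = 0" if "a \<in> \<L>" for a
    using homogeneous_lattice_orthogonal[of \<L> G d a] G \<L> that by simp
  have "\<exists>L. CB_matrix L \<and> range ((*v) L) = \<L>"
  proof (rule ccontr)
    assume no: "\<not> ?thesis"
    \<comment> \<open>Failure of this alternative supplies exactly the two vectors that the
      construction of a CB matrix requires.\<close>
    then have low: "(\<forall>a\<in>\<L>. a $ 3 = 0) \<or> (\<forall>a\<in>\<L>. a $ 3 = 0 \<longrightarrow> a = 0)"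
      using exists_CB_matrix_of_lattice[OF sub d orth] by blast
    obtain p :: "nat ^ 3" and i j where p: "0 < p $ i" "p $ j = 0"
      "\<And>a. a \<in> \<L> \<Longrightarrow> (\<Sum>i\<in>UNIV. int (p $ i) * a $ i) = 0"
      by (rule exists_orthogonal_of_low_rank[OF sub d _ low], erule orth, rule that)
    have "binomial ` \<L> \<subseteq> (ker_xy p d :: 'k poly3 set)"
      using p(3) orth by (auto simp: ker_xy_def ev_binomial_eq_0_iff)
    then have "I \<subseteq> ker_xy p d"
      unfolding \<L> using ideal_gen_subset_iff primeideal_ker(1) primeideal_S_iff by blast
    \<comment> \<open>The chain starts at the kernel for the weights \<open>p\<close> and
      \<open>d\<close>: setting x = 0 enlarges it because \<open>p $ i > 0\<close>, and then y = 0
      because \<open>p $ j = 0\<close> while \<open>d $ j > 0\<close>.\<close>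
    then have "ideal_dim I \<noteq> 1"
      using ideal_dim_neq_1I[OF _ primeideal_ker _ ker_xy_psubset_ker_y[OF p(1)] ker_y_psubset_ker_pt[OF p(2) d]]
        ideal_gen_ideal \<L> by blast
    then show False using dim by simp
  qed
  then obtain L where L: "CB_matrix L" "range ((*v) L) = \<L>" by blast
  have "I = ideal_gen {binomial (column i L) | i. True}"
    unfolding \<L> L(2)[symmetric] by (rule CB_ideal_eq_lattice_ideal[OF L(1), symmetric])
  then show ?thesis using L(1) unfolding CB_ideal_def by blast
qed

theorem theorem8p6:
  fixes I :: "'k::field poly3 set"
  assumes "ideal I S"
  shows "homogeneous_ideal I \<and> lattice_ideal I \<and> ideal_dim I = 1 \<longleftrightarrow> CB_ideal I"
  using lattice_ideal_dim_1_imp_CB_ideal[of I] CB_matrix_imp_lattice_ideal_dim_1[of _ I]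
  unfolding CB_ideal_def by blast

end
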